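(* Let $\mathcal{E},\mathcal{E}'$ be separable complex Hilbert spaces and let $T:\mathcal{E}\to\mathcal{E}'$ be a partial isometry, viewed as a constant function in $H_1^\infty(\mathcal{E},\mathcal{E}')$. Then its Shmul'yan-ter Horst equivalence class is $$\Delta_\infty(T)=\{F(\cdot)=T+D_{T^*}F_0(\cdot)D_T\in H_1^\infty(\mathcal{E},\mathcal{E}') : F_0\in H_1^\infty(\mathcal{D}_T,\mathcal{D}_{T^*}),\ \|F_0\|_\infty<1\}.$$
   Context: $\mathbb{D}$ is the open unit disc. $H_1^\infty(\mathcal{E},\mathcal{E}')$ is the set of analytic functions $F:\mathbb{D}\to\mathcal{B}(\mathcal{E},\mathcal{E}')$ with $\|F\|_\infty:=\sup_{z\in\mathbb{D}}\|F(z)\|\le 1$. $T$ is a partial isometry if $TT^*T=T$. For a contraction $A$ between Hilbert spaces, $D_A=(I-A^*A)^{1/2}$ and $\mathcal{D}_A=\overline{\mathcal{R}(D_A)}$ (and $D_A$ is viewed as an operator into, or from, $\mathcal{D}_A$ as needed). For contractions $A,B\in\mathcal{B}(\mathcal{H}_1,\mathcal{H}_2)$, $A$ Shmul'yan dominates $B$ if $B=A+D_{A^*}XD_A$ for some bounded $X\in\mathcal{B}(\mathcal{D}_A,\mathcal{D}_{A^*})$. For $F\in H_1^\infty(\mathcal{E},\mathcal{E}')$, the Toeplitz operator $T_F:H^2(\mathcal{E})\to H^2(\mathcal{E}')$ between vector-valued Hardy spaces is the contraction $(T_Fg)(\lambda)=F(\lambda)g(\lambda)$. For $F,G\in H_1^\infty(\mathcal{E},\mathcal{E}')$,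 $G$ Shmul'yan-ter Horst dominates $F$ if $T_G$ Shmul'yan dominates $T_F$. $\Delta_\infty(F)$ is the set of all $G\in H_1^\infty(\mathcal{E},\mathcal{E}')$ such that $F$ and $G$ Shmul'yan-ter Horst dominate each other. *)

theory Defs
  imports "HOL-Analysis.Analysis"
begin

section \<open>Complex Hilbert spaces\<close>

text \<open>The inner product is linear in its first argument.\<close>

class chilbert_space = banach +
  fixes scaleC :: "complex \<Rightarrow> 'a \<Rightarrow> 'a"  (infixr \<open>*\<^sub>C\<close> 75)
    and cinner :: "'a \<Rightarrow> 'a \<Rightarrow> complex"
  assumes scaleC_add_right: "c *\<^sub>C (x + y) = c *\<^sub>C x + c *\<^sub>C y"
    and scaleC_add_left: "(c + d) *\<^sub>C x = c *\<^sub>C x + d *\<^sub>C x"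
    and scaleC_scaleC: "c *\<^sub>C d *\<^sub>C x = (c * d) *\<^sub>C x"
    and scaleC_of_real: "complex_of_real r *\<^sub>C x = r *\<^sub>R x"
    and cinner_commute: "cinner x y = cnj (cinner y x)"
    and cinner_add_left: "cinner (x + y) z = cinner x z + cinner y z"
    and cinner_scaleC_left: "cinner (c *\<^sub>C x) y = c * cinner x y"
    and cinner_self: "cinner x x = complex_of_real ((norm x)\<^sup>2)"

lemma scaleC_one [simp]: "1 *\<^sub>C x = (x::'a::chilbert_space)"
  using scaleC_of_real[of 1 x] by simp

lemma scaleC_zero_left [simp]: "0 *\<^sub>C x = (0::'a::chilbert_space)"
  using scaleC_of_real[of 0 x] by simp

lemma norm_scaleC: "norm (c *\<^sub>C x) = cmod c * norm (x::'a::chilbert_space)"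
proof -
  have "cinner (c *\<^sub>C x) (c *\<^sub>C x) = c * cnj (c * cnj (cinner x x))"
    by (metis cinner_commute cinner_scaleC_left complex_cnj_mult complex_cnj_cnj)
  also have "\<dots> = complex_of_real ((cmod c)\<^sup>2 * (norm x)\<^sup>2)"
    using complex_norm_square[of c] by (simp add: cinner_self)
  finally have "(norm (c *\<^sub>C x))\<^sup>2 = (cmod c * norm x)\<^sup>2"
    unfolding cinner_self of_real_eq_iff power_mult_distrib .
  then show ?thesis
    by (simp add: power2_eq_iff_nonneg)
qed

lemma bounded_linear_scaleC: "bounded_linear (\<lambda>x::'a::chilbert_space. c *\<^sub>C x)"
proof (rule bounded_linear_intro)
  show "c *\<^sub>C (x + y) = c *\<^sub>C x + c *\<^sub>C y" for x y :: 'a by (rule scaleC_add_right)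
  show "c *\<^sub>C r *\<^sub>R x = r *\<^sub>R c *\<^sub>C x" for r and x :: 'a
    by (simp add: scaleC_of_real[symmetric] scaleC_scaleC mult.commute)
  show "norm (c *\<^sub>C x) \<le> norm x * cmod c" for x :: 'a by (simp add: norm_scaleC)
qed

lemma cinner_add_right: "cinner z (x + y) = cinner z x + cinner z (y::'a::chilbert_space)"
  by (metis cinner_add_left cinner_commute complex_cnj_add)

lemma cinner_scaleC_right: "cinner x (c *\<^sub>C y) = cnj c * cinner x (y::'a::chilbert_space)"
  by (metis cinner_commute cinner_scaleC_left complex_cnj_mult)

lemma cinner_zero_left [simp]: "cinner 0 (y::'a::chilbert_space) = 0"
  using cinner_add_left[of 0 0 y] by simp

lemma cinner_zero_right [simp]: "cinner (y::'a::chilbert_space) 0 = 0"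
  using cinner_add_right[of y 0 0] by simp

lemma cinner_scaleR_left: "cinner (r *\<^sub>R x) y = complex_of_real r * cinner x (y::'a::chilbert_space)"
  by (metis scaleC_of_real cinner_scaleC_left)

lemma cmod_cinner_le: "cmod (cinner x y) \<le> norm x * norm (y::'a::chilbert_space)"
proof (cases "y = 0")
  case False
  then have ny: "norm y > 0" by simp
  define c where "c = - cinner x y / complex_of_real ((norm y)\<^sup>2)"
  let ?p = "cinner x y"
  have "complex_of_real ((norm (x + c *\<^sub>C y))\<^sup>2)
      = cinner x x + cnj c * ?p + c * cnj ?p + c * cnj c * cinner y y"
    unfolding cinner_self[symmetric]
    by (simp add: cinner_add_left cinner_add_right cinner_scaleC_left cinner_scaleC_right
        algebra_simps cinner_commute[of y x])
  also have "\<dots> = complex_of_real ((norm x)\<^sup>2) - ?p * cnj ?p / complex_of_real ((norm y)\<^sup>2)"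
    using ny by (simp add: c_def cinner_self field_simps power2_eq_square)
  also have "\<dots> = complex_of_real ((norm x)\<^sup>2 - (cmod ?p)\<^sup>2 / (norm y)\<^sup>2)"
    using complex_norm_square[of ?p] by simp
  finally have "(norm (x + c *\<^sub>C y))\<^sup>2 = (norm x)\<^sup>2 - (cmod ?p)\<^sup>2 / (norm y)\<^sup>2"
    using of_real_eq_iff by blast
  then have "(cmod ?p)\<^sup>2 / (norm y)\<^sup>2 \<le> (norm x)\<^sup>2"
    by (metis diff_ge_0_iff_ge zero_le_power2)
  then have "(cmod ?p)\<^sup>2 \<le> (norm x * norm y)\<^sup>2"
    using ny by (simp add: field_simps power_mult_distrib)
  then show ?thesis
    by (rule power2_le_imp_le) simp
qed simp

lemma bounded_linear_cinner_left: "bounded_linear (\<lambda>x::'a::chilbert_space. cinner x y)"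
proof (rule bounded_linear_intro)
  show "cinner (u + v) y = cinner u y + cinner v y" for u v :: 'a by (rule cinner_add_left)
  show "cinner (r *\<^sub>R u) y = r *\<^sub>R cinner u y" for r and u :: 'a
    by (simp add: cinner_scaleR_left scaleR_conv_of_real)
  show "norm (cinner u y) \<le> norm u * norm y" for u :: 'a by (rule cmod_cinner_le)
qed


section \<open>The vector-valued Hardy space as a Hilbert space\<close>

definition sqsummable :: "(nat \<Rightarrow> 'a::real_normed_vector) \<Rightarrow> bool" where
  "sqsummable a \<longleftrightarrow> summable (\<lambda>n. (norm (a n))\<^sup>2)"

text \<open>Functions on the unit disc are \<^const>\<open>extensional\<close> (\<^const>\<open>undefined\<close> off the disc), so that
  equality of functions is equality on the disc.\<close>

definition taylor_fun :: "(nat \<Rightarrow> 'a::chilbert_space) \<Rightarrow> complex \<Rightarrow> 'a" where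
  "taylor_fun a = (\<lambda>z\<in>ball 0 1. \<Sum>n. z ^ n *\<^sub>C a n)"

lemma sqsummable_zero: "sqsummable (\<lambda>_. 0)"
  by (simp add: sqsummable_def)

lemma sqsummable_add:
  assumes "sqsummable a" "sqsummable b"
  shows "sqsummable (\<lambda>n. a n + b n)"
  unfolding sqsummable_def
proof (rule summable_comparison_test')
  show "summable (\<lambda>n. 2 * (norm (a n))\<^sup>2 + 2 * (norm (b n))\<^sup>2)"
    using assms unfolding sqsummable_def by (intro summable_add summable_mult)
  fix n
  have "(norm (a n + b n))\<^sup>2 \<le> (norm (a n) + norm (b n))\<^sup>2"
    by (intro power_mono norm_triangle_ineq) simp
  also have "\<dots> \<le> 2 * (norm (a n))\<^sup>2 + 2 * (norm (b n))\<^sup>2"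
    using sum_squares_bound[of "norm (a n)" "norm (b n)"] by (simp add: power2_sum)
  finally show "norm ((norm (a n + b n))\<^sup>2) \<le> 2 * (norm (a n))\<^sup>2 + 2 * (norm (b n))\<^sup>2"
    by simp
qed

lemma sqsummable_scaleC:
  "sqsummable a \<Longrightarrow> sqsummable (\<lambda>n. c *\<^sub>C (a n :: 'a::chilbert_space))"
  unfolding sqsummable_def norm_scaleC power_mult_distrib by (rule summable_mult)

lemma sqsummable_scaleR: "sqsummable a \<Longrightarrow> sqsummable (\<lambda>n. r *\<^sub>R a n)"
  unfolding sqsummable_def norm_scaleR power_mult_distrib by (rule summable_mult)

lemma sqsummable_uminus: "sqsummable a \<Longrightarrow> sqsummable (\<lambda>n. - a n)"
  by (simp add: sqsummable_def)

lemma sqsummable_diff: "sqsummable a \<Longrightarrow> sqsummable b \<Longrightarrow> sqsummable (\<lambda>n. a n - b n)"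
  using sqsummable_add[of a "\<lambda>n. - b n"] by (simp add: sqsummable_uminus)

lemma summable_taylor:
  fixes a :: "nat \<Rightarrow> 'a::chilbert_space"
  assumes "sqsummable a" "cmod z < 1"
  shows "summable (\<lambda>n. z ^ n *\<^sub>C a n)"
proof (rule summable_comparison_test')
  have "summable (\<lambda>n. ((cmod z)\<^sup>2) ^ n)"
    using assms(2) by (intro summable_geometric) (simp add: power_less_one_iff abs_square_less_1)
  then show "summable (\<lambda>n. ((cmod z)\<^sup>2) ^ n + (norm (a n))\<^sup>2)"
    using assms(1) unfolding sqsummable_def by (rule summable_add)
  fix n
  have "2 * (cmod z ^ n * norm (a n)) \<le> (cmod z ^ n)\<^sup>2 + (norm (a n))\<^sup>2"
    using sum_squares_bound[of "cmod z ^ n" "norm (a n)"] by simp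
  moreover have "0 \<le> cmod z ^ n * norm (a n)" by simp
  ultimately have "cmod z ^ n * norm (a n) \<le> (cmod z ^ n)\<^sup>2 + (norm (a n))\<^sup>2"
    by linarith
  then show "norm (z ^ n *\<^sub>C a n) \<le> ((cmod z)\<^sup>2) ^ n + (norm (a n))\<^sup>2"
    by (simp add: norm_scaleC norm_power power_mult[symmetric] mult.commute)
qed

lemma taylor_fun_inject:
  fixes a b :: "nat \<Rightarrow> 'a::chilbert_space"
  assumes a: "sqsummable a" and b: "sqsummable b" and eq: "taylor_fun a = taylor_fun b"
  shows "a = b"
proof -
  have sums: "(\<lambda>n. cinner (c n) y * z ^ n) sums cinner (taylor_fun c z) y"
    if "sqsummable c" "z \<in> ball 0 1" for c :: "nat \<Rightarrow> 'a" and y z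
  proof -
    have "(\<lambda>n. z ^ n *\<^sub>C c n) sums taylor_fun c z"
      using summable_taylor[OF that(1)] that(2) by (simp add: taylor_fun_def summable_sums)
    from bounded_linear.sums[OF bounded_linear_cinner_left[of y] this]
    show ?thesis by (simp add: cinner_scaleC_left mult.commute)
  qed
  have "cinner (a n) y = cinner (b n) y" for n y
  proof -
    let ?f = "\<lambda>c. Abs_fps (\<lambda>n. cinner (c n) y)"
    have rad: "fps_conv_radius (?f c) > 0" if "sqsummable c" for c
    proof -
      have "summable (\<lambda>n. cinner (c n) y * (1/2) ^ n)"
        using sums[OF that, of "1/2"] by (intro sums_summable) simp
      then have "conv_radius (\<lambda>n. cinner (c n) y) \<ge> norm (1/2 :: complex)"
        by (rule conv_radius_geI)
      moreover have "(0::ereal) < ereal (norm (1/2 :: complex))" by simp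
      ultimately show ?thesis
        unfolding fps_conv_radius_def fps_nth_Abs_fps
        using less_le_trans by blast
    qed
    have "eventually (\<lambda>z. z \<in> ball 0 1) (nhds (0::complex))"
      by (rule eventually_nhds_in_open) auto
    then have "eventually (\<lambda>z. eval_fps (?f a) z = eval_fps (?f b) z) (nhds 0)"
    proof eventually_elim
      case (elim z)
      then show ?case
        using sums[OF a elim] sums[OF b elim] eq by (simp add: eval_fps_def sums_iff)
    qed
    then have "?f a = ?f b"
      by (intro eval_fps_eqD rad a b)
    then show ?thesis
      by (metis fps_nth_Abs_fps)
  qed
  then have "cinner (a n - b n) (a n - b n) = 0" for n
    using cinner_add_left[of "a n - b n" "b n" "a n - b n"] by simp
  then show "a = b"
    by (auto simp: cinner_self fun_eq_iff)
qed

lemma taylor_fun_zero: "taylor_fun (\<lambda>_. 0) = (\<lambda>z\<in>ball 0 1. 0 :: 'a::chilbert_space)"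
proof -
  have "c *\<^sub>C (0::'a) = 0" for c
    using bounded_linear.linear[OF bounded_linear_scaleC] by (rule linear_0)
  then show ?thesis by (simp add: taylor_fun_def)
qed

lemma taylor_fun_add:
  assumes "sqsummable a" "sqsummable b"
  shows "taylor_fun (\<lambda>n. a n + b n) = (\<lambda>z\<in>ball 0 1. taylor_fun a z + taylor_fun b z)"
  unfolding taylor_fun_def
  by (auto simp: restrict_def fun_eq_iff scaleC_add_right intro!: suminf_add[symmetric]
      summable_taylor assms)

lemma taylor_fun_scaleC:
  assumes "sqsummable a"
  shows "taylor_fun (\<lambda>n. c *\<^sub>C a n) = (\<lambda>z\<in>ball 0 1. c *\<^sub>C taylor_fun a z)"
proof -
  have "(\<Sum>n. z ^ n *\<^sub>C c *\<^sub>C a n) = c *\<^sub>C (\<Sum>n. z ^ n *\<^sub>C a n)" if "cmod z < 1" for z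
  proof -
    have "c *\<^sub>C (\<Sum>n. z ^ n *\<^sub>C a n) = (\<Sum>n. c *\<^sub>C z ^ n *\<^sub>C a n)"
      by (rule bounded_linear.suminf[OF bounded_linear_scaleC summable_taylor[OF assms that]])
    then show ?thesis by (simp add: scaleC_scaleC mult.commute)
  qed
  then show ?thesis
    unfolding taylor_fun_def by (auto simp: restrict_def fun_eq_iff)
qed

lemma taylor_fun_scaleR:
  "sqsummable a \<Longrightarrow> taylor_fun (\<lambda>n. r *\<^sub>R a n) = (\<lambda>z\<in>ball 0 1. r *\<^sub>R taylor_fun a z)"
  using taylor_fun_scaleC[of a "complex_of_real r"] by (simp add: scaleC_of_real)

text \<open>Analytic functions on the disc with square-summable Taylor coefficients.\<close>

typedef (overloaded) 'a hardy2 =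
  "{g :: complex \<Rightarrow> 'a::chilbert_space. \<exists>a. sqsummable a \<and> g = taylor_fun a}"
  morphisms hardy_fun Abs_hardy2
  using sqsummable_zero by blast

setup_lifting type_definition_hardy2

definition hardy_coeff :: "'a::chilbert_space hardy2 \<Rightarrow> nat \<Rightarrow> 'a" where
  "hardy_coeff g = (THE a. sqsummable a \<and> hardy_fun g = taylor_fun a)"

lemma hardy_coeff_unique:
  "sqsummable a \<Longrightarrow> hardy_fun g = taylor_fun a \<Longrightarrow> hardy_coeff g = a"
  unfolding hardy_coeff_def by (rule the_equality) (auto intro: taylor_fun_inject)

lemma
  shows sqsummable_hardy_coeff: "sqsummable (hardy_coeff g)"
    and hardy_fun_eq: "hardy_fun g = taylor_fun (hardy_coeff g)"
  using hardy_fun[of g] hardy_coeff_unique[of _ g] by auto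

lemma hardy_eqI: "(\<And>n. hardy_coeff f n = hardy_coeff g n) \<Longrightarrow> f = g"
  by (metis ext hardy_fun_eq hardy_fun_inject)

lemma hardy_coeff_Abs: "sqsummable a \<Longrightarrow> hardy_coeff (Abs_hardy2 (taylor_fun a)) = a"
  by (rule hardy_coeff_unique) (auto intro!: Abs_hardy2_inverse)

instantiation hardy2 :: (chilbert_space) real_normed_vector
begin

lift_definition zero_hardy2 :: "'a hardy2" is "\<lambda>z\<in>ball 0 1. 0"
  using sqsummable_zero taylor_fun_zero by metis

lift_definition plus_hardy2 :: "'a hardy2 \<Rightarrow> 'a hardy2 \<Rightarrow> 'a hardy2"
  is "\<lambda>f g. \<lambda>z\<in>ball 0 1. f z + g z"
  using sqsummable_add taylor_fun_add by metis

lift_definition scaleR_hardy2 :: "real \<Rightarrow> 'a hardy2 \<Rightarrow> 'a hardy2"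
  is "\<lambda>r f. \<lambda>z\<in>ball 0 1. r *\<^sub>R f z"
  using sqsummable_scaleR taylor_fun_scaleR by metis

definition uminus_hardy2 :: "'a hardy2 \<Rightarrow> 'a hardy2" where
  "uminus_hardy2 f = (-1) *\<^sub>R f"

definition minus_hardy2 :: "'a hardy2 \<Rightarrow> 'a hardy2 \<Rightarrow> 'a hardy2" where
  "minus_hardy2 f g = f + - g"

definition norm_hardy2 :: "'a hardy2 \<Rightarrow> real" where
  "norm_hardy2 f = sqrt (\<Sum>n. (norm (hardy_coeff f n))\<^sup>2)"

definition dist_hardy2 :: "'a hardy2 \<Rightarrow> 'a hardy2 \<Rightarrow> real" where
  "dist_hardy2 f g = norm (f - g)"

definition sgn_hardy2 :: "'a hardy2 \<Rightarrow> 'a hardy2" where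
  "sgn_hardy2 f = inverse (norm f) *\<^sub>R f"

definition uniformity_hardy2 :: "('a hardy2 \<times> 'a hardy2) filter" where
  "uniformity_hardy2 = (INF e\<in>{0<..}. principal {(x, y). dist x y < e})"

definition open_hardy2 :: "'a hardy2 set \<Rightarrow> bool" where
  "open_hardy2 S = (\<forall>x\<in>S. \<forall>\<^sub>F (x', y) in uniformity. x' = x \<longrightarrow> y \<in> S)"

lemma hardy_coeff_zero: "hardy_coeff (0::'a hardy2) = (\<lambda>n. 0)"
  by (intro hardy_coeff_unique sqsummable_zero)
    (simp add: zero_hardy2.rep_eq taylor_fun_zero)

lemma hardy_coeff_add:
  "hardy_coeff (f + g) = (\<lambda>n. hardy_coeff f n + hardy_coeff (g::'a hardy2) n)"
  by (intro hardy_coeff_unique sqsummable_add sqsummable_hardy_coeff)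
    (simp add: plus_hardy2.rep_eq taylor_fun_add sqsummable_hardy_coeff flip: hardy_fun_eq)

lemma hardy_coeff_scaleR:
  "hardy_coeff (r *\<^sub>R f) = (\<lambda>n. r *\<^sub>R hardy_coeff (f::'a hardy2) n)"
  by (intro hardy_coeff_unique sqsummable_scaleR sqsummable_hardy_coeff)
    (simp add: scaleR_hardy2.rep_eq taylor_fun_scaleR sqsummable_hardy_coeff flip: hardy_fun_eq)

lemma hardy_coeff_uminus: "hardy_coeff (- f) = (\<lambda>n. - hardy_coeff (f::'a hardy2) n)"
  by (simp add: uminus_hardy2_def hardy_coeff_scaleR)

lemma hardy_coeff_diff:
  "hardy_coeff (f - g) = (\<lambda>n. hardy_coeff f n - hardy_coeff (g::'a hardy2) n)"
  by (simp add: minus_hardy2_def hardy_coeff_add hardy_coeff_uminus)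

lemmas hardy_coeff_simps = hardy_coeff_zero hardy_coeff_add
  hardy_coeff_scaleR hardy_coeff_uminus hardy_coeff_diff

lemma summable_hardy_coeff: "summable (\<lambda>n. (norm (hardy_coeff (f::'a hardy2) n))\<^sup>2)"
  using sqsummable_hardy_coeff unfolding sqsummable_def .

lemma L2_set_le_norm_hardy2: "L2_set (\<lambda>n. norm (hardy_coeff f n)) {..<N} \<le> norm (f::'a hardy2)"
  unfolding L2_set_def norm_hardy2_def
  by (intro real_sqrt_le_mono sum_le_suminf summable_hardy_coeff) auto

lemma norm_hardy2_leI:
  assumes "\<And>N. L2_set (\<lambda>n. norm (hardy_coeff (f::'a hardy2) n)) {..<N} \<le> B"
  shows "norm f \<le> B"
proof -
  have B: "0 \<le> B"
    using assms[of 0] by simp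
  have "(\<Sum>n<N. (norm (hardy_coeff f n))\<^sup>2) \<le> B\<^sup>2" for N
    using assms[of N] unfolding L2_set_def by (rule sqrt_le_D)
  then have "(\<Sum>n. (norm (hardy_coeff f n))\<^sup>2) \<le> B\<^sup>2"
    by (intro suminf_le_const summable_hardy_coeff)
  then show ?thesis
    unfolding norm_hardy2_def using B by (simp add: real_le_lsqrt suminf_nonneg summable_hardy_coeff)
qed

lemma norm_hardy_coeff_le: "norm (hardy_coeff f n) \<le> norm (f::'a hardy2)"
proof -
  have "norm (hardy_coeff f n) \<le> L2_set (\<lambda>n. norm (hardy_coeff f n)) {..<Suc n}"
    by (rule member_le_L2_set) auto
  then show ?thesis
    using L2_set_le_norm_hardy2 order_trans by blast
qed

lemma hardy2_normed:
  fixes f g :: "'a hardy2"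
  shows hardy2_norm_eq_0: "norm f = 0 \<longleftrightarrow> f = 0"
    and hardy2_norm_triangle: "norm (f + g) \<le> norm f + norm g"
proof -
  show "norm f = 0 \<longleftrightarrow> f = 0"
  proof
    assume "norm f = 0"
    then have "hardy_coeff f n = 0" for n
      using norm_hardy_coeff_le[of f n] by simp
    then show "f = 0" by (intro hardy_eqI) (simp add: hardy_coeff_zero)
  qed (simp add: norm_hardy2_def hardy_coeff_zero)
  show "norm (f + g) \<le> norm f + norm g"
  proof (rule norm_hardy2_leI)
    fix N
    have "L2_set (\<lambda>n. norm (hardy_coeff (f + g) n)) {..<N}
        \<le> L2_set (\<lambda>n. norm (hardy_coeff f n) + norm (hardy_coeff g n)) {..<N}"
      by (intro L2_set_mono) (auto simp: hardy_coeff_add norm_triangle_ineq)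
    also have "\<dots> \<le> L2_set (\<lambda>n. norm (hardy_coeff f n)) {..<N}
        + L2_set (\<lambda>n. norm (hardy_coeff g n)) {..<N}"
      by (rule L2_set_triangle_ineq)
    also have "\<dots> \<le> norm f + norm g"
      by (intro add_mono L2_set_le_norm_hardy2)
    finally show "L2_set (\<lambda>n. norm (hardy_coeff (f + g) n)) {..<N} \<le> norm f + norm g" .
  qed
qed

lemma hardy2_norm_scaleR: "norm (r *\<^sub>R f) = \<bar>r\<bar> * norm (f::'a hardy2)"
  by (simp add: norm_hardy2_def hardy_coeff_scaleR power_mult_distrib
      suminf_mult summable_hardy_coeff real_sqrt_mult)

instance
proof
  fix f g h :: "'a hardy2" and r s :: real
  show "f + g + h = f + (g + h)" "f + g = g + f" "0 + f = f" "- f + f = 0" "f - g = f + - g"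
    "r *\<^sub>R (f + g) = r *\<^sub>R f + r *\<^sub>R g" "(r + s) *\<^sub>R f = r *\<^sub>R f + s *\<^sub>R f"
    "r *\<^sub>R s *\<^sub>R f = (r * s) *\<^sub>R f" "1 *\<^sub>R f = f"
    by (rule hardy_eqI, simp add: hardy_coeff_simps algebra_simps)+
  show "dist f g = norm (f - g)" by (rule dist_hardy2_def)
  show "sgn f = inverse (norm f) *\<^sub>R f" by (rule sgn_hardy2_def)
  show "uniformity = (INF e\<in>{0<..}. principal {(x, y::'a hardy2). dist x y < e})"
    by (rule uniformity_hardy2_def)
  show "open U \<longleftrightarrow> (\<forall>x\<in>U. \<forall>\<^sub>F (x', y) in uniformity. x' = x \<longrightarrow> y \<in> U)" for U :: "'a hardy2 set"
    by (rule open_hardy2_def)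
  show "norm f = 0 \<longleftrightarrow> f = 0" by (rule hardy2_norm_eq_0)
  show "norm (f + g) \<le> norm f + norm g" by (rule hardy2_norm_triangle)
  show "norm (r *\<^sub>R f) = \<bar>r\<bar> * norm f" by (rule hardy2_norm_scaleR)
qed

end

lemma hardy2_complete:
  fixes X :: "nat \<Rightarrow> 'a::chilbert_space hardy2"
  assumes X: "\<And>e. e > 0 \<Longrightarrow> \<exists>M. \<forall>m\<ge>M. \<forall>k\<ge>M. norm (X m - X k) < e"
  shows "\<exists>f. \<forall>e>0. \<exists>M. \<forall>m\<ge>M. norm (X m - f) \<le> e"
proof -
  have "Cauchy (\<lambda>m. hardy_coeff (X m) n)" for n
  proof (rule metric_CauchyI)
    fix e :: real assume "e > 0"
    then obtain M where M: "\<forall>m\<ge>M. \<forall>k\<ge>M. norm (X m - X k) < e" using X by blast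
    have "dist (hardy_coeff (X m) n) (hardy_coeff (X k) n) < e" if "m \<ge> M" "k \<ge> M" for m k
      using norm_hardy_coeff_le[of "X m - X k" n] M that
      by (metis dist_norm hardy_coeff_diff le_less_trans)
    then show "\<exists>M. \<forall>m\<ge>M. \<forall>k\<ge>M. dist (hardy_coeff (X m) n) (hardy_coeff (X k) n) < e"
      by blast
  qed
  then have "\<forall>n. \<exists>l. (\<lambda>m. hardy_coeff (X m) n) \<longlonglongrightarrow> l"
    using Cauchy_convergent_iff convergent_def by blast
  then obtain a where a: "\<And>n. (\<lambda>m. hardy_coeff (X m) n) \<longlonglongrightarrow> a n" by metis
  have bound: "L2_set (\<lambda>n. norm (hardy_coeff (X m) n - a n)) {..<N} \<le> e"
    if M: "\<forall>m\<ge>M. \<forall>k\<ge>M. norm (X m - X k) < e" and m: "m \<ge> M" for e m M N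
  proof (rule LIMSEQ_le_const2)
    show "(\<lambda>k. L2_set (\<lambda>n. norm (hardy_coeff (X m - X k) n)) {..<N})
        \<longlonglongrightarrow> L2_set (\<lambda>n. norm (hardy_coeff (X m) n - a n)) {..<N}"
      unfolding L2_set_def hardy_coeff_diff by (intro tendsto_intros a)
    show "\<exists>K. \<forall>k\<ge>K. L2_set (\<lambda>n. norm (hardy_coeff (X m - X k) n)) {..<N} \<le> e"
    proof (intro exI allI impI)
      fix k assume "k \<ge> M"
      then have "norm (X m - X k) \<le> e" using M m by (simp add: less_imp_le)
      then show "L2_set (\<lambda>n. norm (hardy_coeff (X m - X k) n)) {..<N} \<le> e"
        using L2_set_le_norm_hardy2 order_trans by blast
    qed
  qed
  obtain M1 where M1: "\<forall>m\<ge>M1. \<forall>k\<ge>M1. norm (X m - X k) < 1" using X[of 1] by auto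
  have "(\<Sum>n<N. (norm (hardy_coeff (X M1) n - a n))\<^sup>2) \<le> 1\<^sup>2" for N
    using bound[OF M1 order_refl, of N] unfolding L2_set_def by (rule sqrt_le_D)
  then have "sqsummable (\<lambda>n. hardy_coeff (X M1) n - a n)"
    unfolding sqsummable_def
    by (intro bounded_imp_summable[where B = 1]) (auto simp: lessThan_Suc_atMost[symmetric] simp del: sum.lessThan_Suc)
  from sqsummable_diff[OF sqsummable_hardy_coeff[of "X M1"] this]
  have "sqsummable a" by simp
  then have f: "hardy_coeff (Abs_hardy2 (taylor_fun a)) = a" by (rule hardy_coeff_Abs)
  have "\<exists>M. \<forall>m\<ge>M. norm (X m - Abs_hardy2 (taylor_fun a)) \<le> e" if "e > 0" for e
  proof -
    obtain M where M: "\<forall>m\<ge>M. \<forall>k\<ge>M. norm (X m - X k) < e" using X[OF \<open>e > 0\<close>] by blast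
    have "norm (X m - Abs_hardy2 (taylor_fun a)) \<le> e" if "m \<ge> M" for m
      by (rule norm_hardy2_leI) (simp add: hardy_coeff_diff f bound[OF M that])
    then show ?thesis by blast
  qed
  then show ?thesis by blast
qed

instance hardy2 :: (chilbert_space) banach
proof
  fix X :: "nat \<Rightarrow> 'a hardy2" assume "Cauchy X"
  then obtain f where f: "\<forall>e>0. \<exists>M. \<forall>m\<ge>M. norm (X m - f) \<le> e"
    using hardy2_complete[of X] unfolding Cauchy_def dist_norm by metis
  have "X \<longlonglongrightarrow> f"
  proof (rule metric_LIMSEQ_I)
    fix e :: real assume "e > 0"
    then have "e / 2 > 0" by simp
    with f obtain M where "\<forall>m\<ge>M. norm (X m - f) \<le> e / 2" by blast
    with \<open>e > 0\<close> have "\<forall>m\<ge>M. dist (X m) f < e" by (force simp: dist_norm)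
    then show "\<exists>M. \<forall>m\<ge>M. dist (X m) f < e" by blast
  qed
  then show "convergent X" by (rule convergentI)
qed

instantiation hardy2 :: (chilbert_space) chilbert_space
begin

lift_definition scaleC_hardy2 :: "complex \<Rightarrow> 'a hardy2 \<Rightarrow> 'a hardy2"
  is "\<lambda>c f. \<lambda>z\<in>ball 0 1. c *\<^sub>C f z"
  using sqsummable_scaleC taylor_fun_scaleC by metis

definition cinner_hardy2 :: "'a hardy2 \<Rightarrow> 'a hardy2 \<Rightarrow> complex" where
  "cinner_hardy2 f g = (\<Sum>n. cinner (hardy_coeff f n) (hardy_coeff g n))"

lemma hardy_coeff_scaleC:
  "hardy_coeff (c *\<^sub>C f) = (\<lambda>n. c *\<^sub>C hardy_coeff (f::'a hardy2) n)"
  by (intro hardy_coeff_unique sqsummable_scaleC sqsummable_hardy_coeff)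
    (simp add: scaleC_hardy2.rep_eq taylor_fun_scaleC sqsummable_hardy_coeff flip: hardy_fun_eq)

lemma summable_cinner_hardy:
  "summable (\<lambda>n. cinner (hardy_coeff f n) (hardy_coeff (g::'a hardy2) n))"
proof (rule summable_comparison_test')
  show "summable (\<lambda>n. (norm (hardy_coeff f n))\<^sup>2 + (norm (hardy_coeff g n))\<^sup>2)"
    by (intro summable_add summable_hardy_coeff)
  fix n
  have "cmod (cinner (hardy_coeff f n) (hardy_coeff g n))
      \<le> norm (hardy_coeff f n) * norm (hardy_coeff g n)"
    by (rule cmod_cinner_le)
  also have "\<dots> \<le> (norm (hardy_coeff f n))\<^sup>2 + (norm (hardy_coeff g n))\<^sup>2"
    using sum_squares_bound[of "norm (hardy_coeff f n)" "norm (hardy_coeff g n)"]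
      mult_nonneg_nonneg[OF norm_ge_zero[of "hardy_coeff f n"] norm_ge_zero[of "hardy_coeff g n"]]
    by linarith
  finally show "norm (cinner (hardy_coeff f n) (hardy_coeff g n))
      \<le> (norm (hardy_coeff f n))\<^sup>2 + (norm (hardy_coeff g n))\<^sup>2" .
qed

instance
proof
  fix f g h :: "'a hardy2" and r :: real and c d :: complex
  show "c *\<^sub>C (f + g) = c *\<^sub>C f + c *\<^sub>C g" "(c + d) *\<^sub>C f = c *\<^sub>C f + d *\<^sub>C f"
    "c *\<^sub>C d *\<^sub>C f = (c * d) *\<^sub>C f" "complex_of_real r *\<^sub>C f = r *\<^sub>R f"
    by (rule hardy_eqI, simp add: hardy_coeff_simps hardy_coeff_scaleC scaleC_add_left scaleC_add_right scaleC_scaleC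
        scaleC_of_real)+
  show "cinner f g = cnj (cinner g f)"
    unfolding cinner_hardy2_def
    by (subst bounded_linear.suminf[OF bounded_linear_cnj summable_cinner_hardy])
      (simp flip: cinner_commute)
  show "cinner (f + g) h = cinner f h + cinner g h"
    unfolding cinner_hardy2_def hardy_coeff_add cinner_add_left
    by (intro suminf_add[symmetric] summable_cinner_hardy)
  show "cinner (c *\<^sub>C f) g = c * cinner f g"
    unfolding cinner_hardy2_def hardy_coeff_scaleC cinner_scaleC_left
    by (intro suminf_mult summable_cinner_hardy)
  show "cinner f f = complex_of_real ((norm f)\<^sup>2)"
    unfolding cinner_hardy2_def norm_hardy2_def cinner_self
    by (simp add: suminf_nonneg summable_hardy_coeff suminf_of_real[symmetric] flip: of_real_power)
qed

end


section \<open>Operators between closed subspaces\<close>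

text \<open>A closed subspace of a Hilbert space is given by its carrier set \<open>S\<close>; the whole space is
  \<^const>\<open>UNIV\<close>. An operator on \<open>S\<close> is extensional, i.e. it carries no information off \<open>S\<close>.\<close>

definition bounded_ops :: "'a::chilbert_space set \<Rightarrow> 'b::chilbert_space set \<Rightarrow> ('a \<Rightarrow> 'b) set" where
  "bounded_ops S S' = {A \<in> S \<rightarrow>\<^sub>E S'.
     (\<forall>x\<in>S. \<forall>y\<in>S. A (x + y) = A x + A y) \<and>
     (\<forall>c. \<forall>x\<in>S. A (c *\<^sub>C x) = c *\<^sub>C A x) \<and>
     (\<exists>K. \<forall>x\<in>S. norm (A x) \<le> K * norm x)}"

text \<open>As the library's \<^const>\<open>onorm\<close>, with the supremum over \<open>S\<close> only.\<close>

definition onorm_on :: "'a::chilbert_space set \<Rightarrow> ('a \<Rightarrow> 'b::chilbert_space) \<Rightarrow> real" where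
  "onorm_on S A = (SUP x\<in>S. norm (A x) / norm x)"

definition adj :: "('a::chilbert_space \<Rightarrow> 'b::chilbert_space) \<Rightarrow> 'b \<Rightarrow> 'a" where
  "adj A = (THE B. \<forall>x y. cinner (A x) y = cinner x (B y))"

definition positive_op :: "('a::chilbert_space \<Rightarrow> 'a) \<Rightarrow> bool" where
  "positive_op P \<longleftrightarrow> P \<in> bounded_ops UNIV UNIV \<and> (\<forall>x. cinner (P x) x \<in> \<real>\<^sub>\<ge>\<^sub>0)"

definition sqrt_op :: "('a::chilbert_space \<Rightarrow> 'a) \<Rightarrow> 'a \<Rightarrow> 'a" where
  "sqrt_op P = (THE R. positive_op R \<and> R \<circ> R = P)"

definition contraction :: "('a::chilbert_space \<Rightarrow> 'b::chilbert_space) \<Rightarrow> bool" where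
  "contraction A \<longleftrightarrow> A \<in> bounded_ops UNIV UNIV \<and> onorm A \<le> 1"

definition partial_isometry :: "('a::chilbert_space \<Rightarrow> 'b::chilbert_space) \<Rightarrow> bool" where
  "partial_isometry T \<longleftrightarrow> T \<in> bounded_ops UNIV UNIV \<and> T \<circ> adj T \<circ> T = T"

definition defect_op :: "('a::chilbert_space \<Rightarrow> 'b::chilbert_space) \<Rightarrow> 'a \<Rightarrow> 'a" where
  "defect_op A = sqrt_op (\<lambda>x. x - adj A (A x))"

definition defect_space :: "('a::chilbert_space \<Rightarrow> 'b::chilbert_space) \<Rightarrow> 'a set" where
  "defect_space A = closure (range (defect_op A))"

definition shmulyan_dominates ::
    "('a::chilbert_space \<Rightarrow> 'b::chilbert_space) \<Rightarrow> ('a \<Rightarrow> 'b) \<Rightarrow> bool" where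
  "shmulyan_dominates A B \<longleftrightarrow> contraction A \<and> contraction B \<and>
     (\<exists>X \<in> bounded_ops (defect_space A) (defect_space (adj A)).
        B = (\<lambda>h. A h + defect_op (adj A) (X (defect_op A h))))"


section \<open>Operator-valued analytic functions and Toeplitz operators\<close>

text \<open>Complex differentiability in the operator norm at each point of the disc.\<close>

definition analytic_op ::
    "'a::chilbert_space set \<Rightarrow> 'b::chilbert_space set \<Rightarrow> (complex \<Rightarrow> 'a \<Rightarrow> 'b) \<Rightarrow> bool" where
  "analytic_op S S' F \<longleftrightarrow> (\<forall>z\<in>ball 0 1. \<exists>L \<in> bounded_ops S S'.
     ((\<lambda>w. onorm_on S (\<lambda>x. inverse (w - z) *\<^sub>C (F w x - F z x) - L x)) \<longlongrightarrow> 0) (at z))"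

text \<open>The supremum is taken in \<^typ>\<open>ereal\<close>, so that it is \<open>\<infinity>\<close> for unbounded functions.\<close>

definition Hinf_norm :: "'a::chilbert_space set \<Rightarrow> (complex \<Rightarrow> 'a \<Rightarrow> 'b::chilbert_space) \<Rightarrow> ereal" where
  "Hinf_norm S F = (SUP z\<in>ball 0 1. ereal (onorm_on S (F z)))"

definition Hinf1 ::
    "'a::chilbert_space set \<Rightarrow> 'b::chilbert_space set \<Rightarrow> (complex \<Rightarrow> 'a \<Rightarrow> 'b) set" where
  "Hinf1 S S' = {F \<in> ball 0 1 \<rightarrow>\<^sub>E bounded_ops S S'. analytic_op S S' F \<and> Hinf_norm S F \<le> 1}"

definition toeplitz ::
    "(complex \<Rightarrow> 'a::chilbert_space \<Rightarrow> 'b::chilbert_space) \<Rightarrow> 'a hardy2 \<Rightarrow> 'b hardy2" where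
  "toeplitz F g = Abs_hardy2 (\<lambda>z\<in>ball 0 1. F z (hardy_fun g z))"

definition sth_dominates ::
    "(complex \<Rightarrow> 'a::chilbert_space \<Rightarrow> 'b::chilbert_space) \<Rightarrow> (complex \<Rightarrow> 'a \<Rightarrow> 'b) \<Rightarrow> bool" where
  "sth_dominates G F \<longleftrightarrow> shmulyan_dominates (toeplitz G) (toeplitz F)"

definition Delta_inf ::
    "(complex \<Rightarrow> 'a::chilbert_space \<Rightarrow> 'b::chilbert_space) \<Rightarrow> (complex \<Rightarrow> 'a \<Rightarrow> 'b) set" where
  "Delta_inf F = {G \<in> Hinf1 UNIV UNIV. sth_dominates F G \<and> sth_dominates G F}"

end

theory Submission
  imports Defs "HOL-Complex_Analysis.Cauchy_Integral_Formula"
begin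

text \<open>The Toeplitz operator \<open>A\<close> of the constant \<open>T\<close> is again a partial isometry, acting on Taylor
  coefficients, so its defect operators are the projections \<open>P = I - A\<^sup>*A\<close> and \<open>Q = I - AA\<^sup>*\<close>.
  Hence \<open>A\<close> dominates a contraction \<open>B\<close> iff \<open>B = A + QBP\<close>; testing on constant functions makes this
  a pointwise condition on the symbol. If in turn \<open>B\<close> dominates \<open>A\<close>, then
  \<open>\<parallel>(B - A)h\<parallel> \<le> k \<parallel>D\<^sub>B h\<parallel>\<close>, and since \<open>\<parallel>D\<^sub>B h\<parallel>\<^sup>2 = \<parallel>h\<parallel>\<^sup>2 - \<parallel>Bh\<parallel>\<^sup>2\<close> the operator \<open>B\<close> is a strict
  contraction on the kernel of \<open>A\<close>; testing on reproducing kernels gives the strict bound for the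
  symbol. Conversely a strict bound makes \<open>I - C\<^sup>*C\<close> and \<open>I - CC\<^sup>*\<close> invertible for \<open>C = B - A\<close>,
  which yields the operator showing that \<open>B\<close> dominates \<open>A\<close>.\<close>

section \<open>Operators on Hilbert space\<close>

text \<open>\<open>adj\<close> and \<open>sqrt_op\<close> are definite descriptions and
  \<open>toeplitz\<close> goes through \<open>Abs_hardy2\<close>, so none of them can be used before
  existence is settled. The hardest such point is that multiplication by a bounded analytic symbol
  preserves square-summable Taylor coefficients, with the sharp norm bound. Values on the unit
  circle are avoided: sums over roots of unity, scaled to a radius r < 1, stand in for integrals.
  The defect operators of \<open>B\<close>, unlike those of \<open>A\<close>, have no closed form.
  Both directions get by with D_B^2 = I - B*B and the norm identity it implies. What makes this
  enough is that \<open>A\<close> and C = B - A have orthogonal ranges and orthogonal initial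
  spaces, so that everything reduces to \<open>C\<close> being a strict contraction. The constant
  passes from operator to symbol without loss: the kernel at w in a direction annihilated by
  \<open>T\<close> lies in the kernel of \<open>A\<close>, and its norm and the norm of evaluation
  at w contribute the same factor (1 - |w|^2)^(-1/2), whose square is the value of the scalar kernel
  at w.\<close>

lemma cinner_diff_left: "cinner (x - y) z = cinner x z - cinner y (z::'a::chilbert_space)"
  using cinner_add_left[of "x - y" y z] by simp

lemma cinner_diff_right: "cinner z (x - y) = cinner z x - cinner z (y::'a::chilbert_space)"
  using cinner_add_right[of z "x - y" y] by simp

lemma cinner_scaleR_right: "cinner x (r *\<^sub>R y) = complex_of_real r * cinner x (y::'a::chilbert_space)"
  by (metis scaleC_of_real cinner_scaleC_right complex_cnj_complex_of_real)

lemma Re_cinner_commute: "Re (cinner x y) = Re (cinner y (x::'a::chilbert_space))"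
  by (subst cinner_commute) simp

lemma scaleC_zero_right [simp]: "c *\<^sub>C (0::'a::chilbert_space) = 0"
  using linear_0[OF bounded_linear.linear[OF bounded_linear_scaleC]] .

lemma scaleC_diff_right: "c *\<^sub>C (x - y) = c *\<^sub>C x - c *\<^sub>C (y::'a::chilbert_space)"
  using linear_diff[OF bounded_linear.linear[OF bounded_linear_scaleC]] .

lemma scaleC_minus_right: "c *\<^sub>C (- x) = - (c *\<^sub>C (x::'a::chilbert_space))"
  using linear_neg[OF bounded_linear.linear[OF bounded_linear_scaleC]] .

lemma norm_add_sq:
  "(norm (x + y))\<^sup>2 = (norm x)\<^sup>2 + 2 * Re (cinner x y) + (norm (y::'a::chilbert_space))\<^sup>2"
proof -
  have "complex_of_real ((norm (x + y))\<^sup>2)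
      = complex_of_real ((norm x)\<^sup>2) + (cinner x y + cnj (cinner x y)) + complex_of_real ((norm y)\<^sup>2)"
    unfolding cinner_self[symmetric] cinner_commute[of x y, symmetric]
    by (simp add: cinner_add_left cinner_add_right flip: cinner_commute)
  also have "\<dots> = complex_of_real ((norm x)\<^sup>2 + 2 * Re (cinner x y) + (norm y)\<^sup>2)"
    by (simp add: complex_add_cnj)
  finally show ?thesis
    by (simp only: of_real_eq_iff)
qed

lemma cinner_eqI: "(\<And>y. cinner x y = cinner x' y) \<Longrightarrow> x = (x'::'a::chilbert_space)"
proof -
  assume "\<And>y. cinner x y = cinner x' y"
  then have "cinner (x - x') (x - x') = 0" by (simp add: cinner_diff_left)
  then show ?thesis by (simp add: cinner_self)
qed

lemma cinner_eqI_right: "(\<And>y. cinner y x = cinner y x') \<Longrightarrow> x = (x'::'a::chilbert_space)"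
  by (rule cinner_eqI) (metis cinner_commute)

lemma norm_le_by_cinner:
  assumes "\<And>y. cmod (cinner x y) \<le> K * norm y" "0 \<le> K"
  shows "norm (x::'a::chilbert_space) \<le> K"
proof (cases "x = 0")
  case False
  have "norm x * norm x \<le> K * norm x"
    using assms(1)[of x] by (simp add: cinner_self power2_eq_square norm_mult)
  with False show ?thesis by simp
qed (use assms in simp)

section \<open>The Riesz representation theorem\<close>

lemma quadratic_nonneg_imp_zero:
  fixes a b :: real
  assumes "\<And>t. 0 \<le> a * t\<^sup>2 + t * b"
  shows "b = 0"
proof (rule ccontr)
  assume "b \<noteq> 0"
  \<comment> \<open>Any positive \<open>k\<close> above \<open>a\<close> makes the polynomial
    negative at \<open>- b / k\<close>.\<close>
  define k where "k = \<bar>a\<bar> + 1"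
  have k: "k > 0" "a < k" by (auto simp: k_def)
  have "0 \<le> a * (- b / k)\<^sup>2 + (- b / k) * b" by (rule assms)
  also have "\<dots> = (b\<^sup>2 / k\<^sup>2) * (a - k)"
    using k by (simp add: field_simps power2_eq_square)
  also have "\<dots> < 0"
    using k \<open>b \<noteq> 0\<close> by (intro mult_pos_neg) auto
  finally show False by simp
qed

text \<open>Once \<open>y\<close> represents \<open>\<phi>\<close>, the functional
  \<open>J x\<close> below equals \<open>(norm (x - y))\<^sup>2 - (norm y)\<^sup>2\<close>. The
  representing vector is therefore found as its minimiser.\<close>

lemma riesz_representation:
  fixes \<phi> :: "'a::chilbert_space \<Rightarrow> complex"
  assumes add: "\<And>x y. \<phi> (x + y) = \<phi> x + \<phi> y"
    and scale: "\<And>c x. \<phi> (c *\<^sub>C x) = c * \<phi> x"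
    and bound: "\<And>x. cmod (\<phi> x) \<le> K * norm x"
  obtains y where "\<And>x. \<phi> x = cinner x y"
proof -
  have scaleR: "\<phi> (r *\<^sub>R x) = r * \<phi> x" for r x
    using scale[of "complex_of_real r" x] by (simp add: scaleC_of_real)
  have bl: "bounded_linear \<phi>"
    by (rule bounded_linear_intro[where K = K])
      (simp_all add: add scaleR scaleR_conv_of_real bound mult.commute)
  define J where "J x = (norm x)\<^sup>2 - 2 * Re (\<phi> x)" for x
  have J_ge: "- K\<^sup>2 \<le> J x" for x
  proof -
    have "Re (\<phi> x) \<le> K * norm x"
      using bound[of x] complex_Re_le_cmod[of "\<phi> x"] by linarith
    moreover have "0 \<le> (norm x - K)\<^sup>2" by simp
    ultimately show ?thesis by (simp add: J_def power2_diff algebra_simps)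
  qed
  define m where "m = (INF x. J x)"
  have bdd: "bdd_below (range J)"
    using J_ge by (intro bdd_belowI[where m = "- K\<^sup>2"]) auto
  have m_le: "m \<le> J x" for x
    unfolding m_def by (rule cINF_lower[OF bdd]) simp
  have "\<exists>x. J x < m + 1 / real (Suc n)" for n
    using cINF_less_iff[of UNIV J "m + 1 / real (Suc n)"] bdd by (auto simp: m_def)
  then obtain X where X: "\<And>n. J (X n) < m + 1 / real (Suc n)" by metis
  \<comment> \<open>The parallelogram law, with the midpoint bounded below by \<open>m\<close>:
    almost minimal points are close together, so the minimising sequence is Cauchy.\<close>
  have par: "(norm (x - y))\<^sup>2 \<le> 2 * (J x - m) + 2 * (J y - m)" for x y
  proof -
    have "(norm (x - y))\<^sup>2 + (norm (x + y))\<^sup>2 = 2 * (norm x)\<^sup>2 + 2 * (norm y)\<^sup>2"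
      using norm_add_sq[of x y] norm_add_sq[of x "- y"] cinner_diff_right[of x 0 y] by simp
    moreover have "4 * J ((1/2) *\<^sub>R (x + y)) = (norm (x + y))\<^sup>2 - 4 * Re (\<phi> x) - 4 * Re (\<phi> y)"
      unfolding J_def scaleR add norm_scaleR by (simp add: power2_eq_square field_simps)
    moreover have "m \<le> J ((1/2) *\<^sub>R (x + y))" by (rule m_le)
    ultimately show ?thesis by (simp add: J_def)
  qed
  have "Cauchy X"
  proof (rule CauchyI)
    fix e :: real assume e: "e > 0"
    obtain M where M: "1 / real (Suc M) < e\<^sup>2 / 4"
      using e nat_approx_posE[of "e\<^sup>2 / 4"] by auto
    have "norm (X i - X j) < e" if "i \<ge> M" "j \<ge> M" for i j
    proof -
      have d: "J (X k) - m < e\<^sup>2 / 4" if "k \<ge> M" for k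
      proof -
        have "1 / real (Suc k) \<le> 1 / real (Suc M)"
          using that by (intro divide_left_mono) auto
        then show ?thesis using X[of k] M by linarith
      qed
      have "(norm (X i - X j))\<^sup>2 \<le> 2 * (J (X i) - m) + 2 * (J (X j) - m)"
        by (rule par)
      also have "\<dots> < 2 * (e\<^sup>2 / 4) + 2 * (e\<^sup>2 / 4)"
        by (intro add_strict_mono mult_strict_left_mono d that) auto
      finally have "(norm (X i - X j))\<^sup>2 < e\<^sup>2" by simp
      then show ?thesis
        using e by (simp add: power2_less_imp_less)
    qed
    then show "\<exists>M. \<forall>i\<ge>M. \<forall>j\<ge>M. norm (X i - X j) < e" by blast
  qed
  then obtain y where y: "X \<longlonglongrightarrow> y"
    using Cauchy_convergent_iff convergent_def by blast
  have "(\<lambda>n. J (X n)) \<longlonglongrightarrow> J y"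
    unfolding J_def by (intro tendsto_intros y bounded_linear.tendsto[OF bl])
  moreover have "(\<lambda>n. m + 1 / real (Suc n)) \<longlonglongrightarrow> m + 0"
    by (intro tendsto_intros LIMSEQ_Suc lim_1_over_n)
  ultimately have "J y \<le> m + 0"
    by (rule LIMSEQ_le) (use X less_imp_le in blast)
  then have "J y \<le> m" by simp
  \<comment> \<open>The first variation of \<open>J\<close> at the minimiser \<open>y\<close>
    vanishes in every direction \<open>v\<close>.\<close>
  have Re_eq: "Re (\<phi> v) = Re (cinner v y)" for v
  proof -
    have "0 \<le> (norm v)\<^sup>2 * t\<^sup>2 + t * (2 * (Re (cinner v y) - Re (\<phi> v)))" for t :: real
    proof -
      have "J y \<le> J (y + t *\<^sub>R v)"
        using \<open>J y \<le> m\<close> m_le order_trans by blast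
      then show ?thesis
        by (simp add: J_def norm_add_sq add scaleR cinner_scaleR_right power_mult_distrib
            Re_cinner_commute[of y v] algebra_simps)
    qed
    from quadratic_nonneg_imp_zero[OF this] show ?thesis by simp
  qed
  have "\<phi> v = cinner v y" for v
    using Re_eq[of v] Re_eq[of "\<i> *\<^sub>C v"] by (simp add: scale cinner_scaleC_left complex_eq_iff)
  then show thesis by (rule that)
qed

section \<open>Bounded complex-linear operators on whole spaces\<close>

abbreviation "Bop \<equiv> bounded_ops UNIV UNIV"

text \<open>Gives access to the theory of \<open>bounded_linear\<close>, which knows real scalars
  only; complex homogeneity remains as a separate condition.\<close>

lemma bounded_ops_UNIV_iff:
  "A \<in> Bop \<longleftrightarrow> bounded_linear A \<and> (\<forall>c x. A (c *\<^sub>C x) = c *\<^sub>C A x)"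
proof
  assume A: "A \<in> Bop"
  then obtain K where K: "\<And>x. norm (A x) \<le> K * norm x"
    and add: "\<And>x y. A (x + y) = A x + A y" and sc: "\<And>c x. A (c *\<^sub>C x) = c *\<^sub>C A x"
    by (auto simp: bounded_ops_def)
  have "A (r *\<^sub>R x) = r *\<^sub>R A x" for r x
    using sc[of "complex_of_real r" x] by (simp add: scaleC_of_real)
  then have "bounded_linear A"
    using add K by (intro bounded_linear_intro[where K = K]) (auto simp: mult.commute)
  with sc show "bounded_linear A \<and> (\<forall>c x. A (c *\<^sub>C x) = c *\<^sub>C A x)" by blast
next
  assume A: "bounded_linear A \<and> (\<forall>c x. A (c *\<^sub>C x) = c *\<^sub>C A x)"
  then have "\<exists>K. \<forall>x. norm (A x) \<le> K * norm x"
    using bounded_linear.bounded[of A] by (auto simp: mult.commute)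
  with A show "A \<in> Bop"
    by (auto simp: bounded_ops_def linear_add[OF bounded_linear.linear])
qed

lemma Bop_bounded_linear: "A \<in> Bop \<Longrightarrow> bounded_linear A"
  by (simp add: bounded_ops_UNIV_iff)

lemma Bop_scaleC: "A \<in> Bop \<Longrightarrow> A (c *\<^sub>C x) = c *\<^sub>C A x"
  by (simp add: bounded_ops_UNIV_iff)

lemma Bop_add: "A \<in> Bop \<Longrightarrow> A (x + y) = A x + A y"
  by (simp add: Bop_bounded_linear linear_add[OF bounded_linear.linear])

lemma Bop_diff: "A \<in> Bop \<Longrightarrow> A (x - y) = A x - A y"
  by (simp add: Bop_bounded_linear linear_diff[OF bounded_linear.linear])

lemma Bop_minus: "A \<in> Bop \<Longrightarrow> A (- x) = - A x"
  by (simp add: Bop_bounded_linear linear_neg[OF bounded_linear.linear])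

lemma Bop_zero: "A \<in> Bop \<Longrightarrow> A 0 = 0"
  by (simp add: Bop_bounded_linear linear_0[OF bounded_linear.linear])

lemma Bop_bounded: "A \<in> Bop \<Longrightarrow> \<exists>K\<ge>0. \<forall>x. norm (A x) \<le> K * norm x"
  using bounded_linear.nonneg_bounded[OF Bop_bounded_linear] by (metis mult.commute)

lemma Bop_comp: "A \<in> Bop \<Longrightarrow> B \<in> Bop \<Longrightarrow> (\<lambda>x. A (B x)) \<in> Bop"
  by (simp add: bounded_ops_UNIV_iff bounded_linear_compose)

lemma Bop_sub: "A \<in> Bop \<Longrightarrow> B \<in> Bop \<Longrightarrow> (\<lambda>x. A x - B x) \<in> Bop"
  by (simp add: bounded_ops_UNIV_iff bounded_linear_sub scaleC_diff_right)

lemma Bop_uminus: "A \<in> Bop \<Longrightarrow> (\<lambda>x. - A x) \<in> Bop"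
  by (simp add: bounded_ops_UNIV_iff bounded_linear_minus scaleC_minus_right)

lemma Bop_id: "(\<lambda>x. x) \<in> Bop"
  by (simp add: bounded_ops_UNIV_iff bounded_linear_ident)

lemma contraction_iff: "contraction A \<longleftrightarrow> A \<in> Bop \<and> (\<forall>x. norm (A x) \<le> norm x)"
proof -
  have "norm (A x) \<le> norm x" if A: "A \<in> Bop" "onorm A \<le> 1" for x
  proof -
    have "norm (A x) \<le> onorm A * norm x" by (rule onorm[OF Bop_bounded_linear[OF A(1)]])
    also have "\<dots> \<le> 1 * norm x" by (intro mult_right_mono A) simp
    finally show ?thesis by simp
  qed
  moreover have "onorm A \<le> 1" if "\<forall>x. norm (A x) \<le> norm x"
    using that by (intro onorm_bound) auto
  ultimately show ?thesis by (auto simp: contraction_def)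
qed


subsection \<open>Adjoints\<close>

lemma adj_eqI:
  assumes "\<And>x y. cinner (A x) y = cinner x (B y)"
  shows "adj A = B"
  unfolding adj_def
proof (rule the_equality)
  show "\<forall>x y. cinner (A x) y = cinner x (B y)" using assms by blast
  fix B' assume "\<forall>x y. cinner (A x) y = cinner x (B' y)"
  then show "B' = B" using assms by (intro ext cinner_eqI_right) metis
qed

lemma adj_cinner:
  fixes A :: "'a::chilbert_space \<Rightarrow> 'b::chilbert_space"
  assumes "A \<in> Bop"
  shows "cinner (A x) y = cinner x (adj A y)"
proof -
  obtain K where K: "\<And>x. norm (A x) \<le> K * norm x" using Bop_bounded[OF assms] by blast
  have "\<exists>w. \<forall>x. cinner (A x) y = cinner x w" for y
  proof -
    have "cmod (cinner (A x) y) \<le> (K * norm y) * norm x" for x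
    proof -
      have "cmod (cinner (A x) y) \<le> norm (A x) * norm y" by (rule cmod_cinner_le)
      also have "\<dots> \<le> (K * norm x) * norm y" by (intro mult_right_mono K) simp
      finally show ?thesis by (simp add: mult_ac)
    qed
    then obtain w where "\<And>x. cinner (A x) y = cinner x w"
      using riesz_representation[of "\<lambda>x. cinner (A x) y" "K * norm y"]
      by (metis Bop_add[OF assms] Bop_scaleC[OF assms] cinner_add_left cinner_scaleC_left)
    then show ?thesis by blast
  qed
  then obtain B where B: "\<And>x y. cinner (A x) y = cinner x (B y)" by metis
  then show ?thesis using adj_eqI[OF B] by simp
qed

lemma adj_cinner': "A \<in> Bop \<Longrightarrow> cinner (adj A y) x = cinner y (A x)"
  by (metis adj_cinner cinner_commute)

text \<open>Stated for a formal adjoint pair, so that it applies to \<open>adj A\<close> before that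
  is known to be an operator.\<close>

lemma adjoint_pair_norm_le:
  fixes A :: "'a::chilbert_space \<Rightarrow> 'b::chilbert_space"
  assumes AB: "\<And>x y. cinner (A x) y = cinner x (B y)"
    and K: "\<And>y. norm (B y) \<le> K * norm y" "0 \<le> K"
  shows "norm (A x) \<le> K * norm x"
proof (rule norm_le_by_cinner)
  fix y
  have "cmod (cinner (A x) y) \<le> norm x * norm (B y)" unfolding AB by (rule cmod_cinner_le)
  also have "\<dots> \<le> norm x * (K * norm y)" by (intro mult_left_mono K) simp
  finally show "cmod (cinner (A x) y) \<le> K * norm x * norm y" by (simp add: mult_ac)
qed (use K in simp)

text \<open>Having a formal adjoint forces linearity. This serves \<open>adj A\<close> and, in
  \<open>square_root_exists\<close>, the limit \<open>Z\<close>.\<close>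

lemma adjoint_pair_Bop:
  fixes A :: "'a::chilbert_space \<Rightarrow> 'b::chilbert_space"
  assumes AB: "\<And>x y. cinner (A x) y = cinner x (B y)"
    and K: "\<And>x. norm (A x) \<le> K * norm x"
  shows "A \<in> Bop"
proof -
  have "A (x + y) = A x + A y" for x y
    by (rule cinner_eqI) (simp add: AB cinner_add_left)
  moreover have "A (c *\<^sub>C x) = c *\<^sub>C A x" for c x
    by (rule cinner_eqI) (simp add: AB cinner_scaleC_left)
  ultimately show ?thesis using K by (auto simp: bounded_ops_def)
qed

lemma norm_adj_le:
  assumes "A \<in> Bop" "\<And>x. norm (A x) \<le> K * norm x" "0 \<le> K"
  shows "norm (adj A y) \<le> K * norm y"
  using adjoint_pair_norm_le[of "adj A" A K y] assms by (simp add: adj_cinner')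

lemma adj_Bop: "A \<in> Bop \<Longrightarrow> adj A \<in> Bop"
  using Bop_bounded[of A] adjoint_pair_Bop[of "adj A" A] norm_adj_le[of A]
  by (metis adj_cinner')

lemma adj_adj: "A \<in> Bop \<Longrightarrow> adj (adj A) = A"
  by (rule adj_eqI) (rule adj_cinner')

lemma adj_sub:
  assumes "A \<in> Bop" "B \<in> Bop"
  shows "adj (\<lambda>x. A x - B x) = (\<lambda>y. adj A y - adj B y)"
  by (rule adj_eqI) (simp add: cinner_diff_left cinner_diff_right adj_cinner assms)

lemma contraction_adj: "contraction A \<Longrightarrow> contraction (adj A)"
  using norm_adj_le[of A 1] by (auto simp: contraction_iff adj_Bop)


subsection \<open>Square roots\<close>

lemma positive_op_Re: "positive_op R \<Longrightarrow> 0 \<le> Re (cinner (R x) x)"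
  by (auto simp: positive_op_def complex_nonneg_Reals_iff)

text \<open>Polarisation: a quadratic form with real values comes from a hermitian form. Expanding
  at \<open>x + y\<close> settles the imaginary part, and replacing \<open>y\<close> by its multiple
  by \<open>\<i>\<close> the real part.\<close>

lemma positive_op_selfadjoint:
  assumes "positive_op R"
  shows "cinner (R x) y = cinner x (R y)"
proof -
  have R: "R \<in> Bop" using assms by (simp add: positive_op_def)
  have im: "Im (cinner (R x) x) = 0" for x
    using assms by (auto simp: positive_op_def complex_nonneg_Reals_iff)
  have 1: "Im (cinner (R x) y) = - Im (cinner (R y) x)" for x y
    using im[of "x + y"] im[of x] im[of y]
    by (simp add: Bop_add[OF R] cinner_add_left cinner_add_right)
  have 2: "Re (cinner (R x) y) = Re (cinner (R y) x)"
    using 1[of x "\<i> *\<^sub>C y"] by (simp add: Bop_scaleC[OF R] cinner_scaleC_left cinner_scaleC_right)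
  have "cinner (R x) y = cnj (cinner (R y) x)"
    using 1[of x y] 2 by (simp add: complex_eq_iff)
  then show ?thesis by (simp flip: cinner_commute)
qed

text \<open>At a zero \<open>y\<close> of the nonnegative form its derivative must vanish; in the
  direction \<open>R y\<close> this derivative is twice the squared norm of
  \<open>R y\<close>.\<close>

lemma positive_op_null:
  assumes R: "positive_op R" and 0: "Re (cinner (R y) y) = 0"
  shows "R y = 0"
proof -
  have B: "R \<in> Bop" using R by (simp add: positive_op_def)
  have "0 \<le> Re (cinner (R (R y)) (R y)) * t\<^sup>2 + t * (2 * (norm (R y))\<^sup>2)" for t :: real
  proof -
    have "0 \<le> Re (cinner (R (y + t *\<^sub>R R y)) (y + t *\<^sub>R R y))"
      by (rule positive_op_Re[OF R])
    also have "R (y + t *\<^sub>R R y) = R y + t *\<^sub>R R (R y)"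
      by (metis B Bop_add Bop_scaleC scaleC_of_real)
    finally show ?thesis
      using 0 positive_op_selfadjoint[OF R, of "R y" y]
      by (simp add: cinner_add_left cinner_add_right cinner_scaleR_left cinner_scaleR_right
          cinner_self power2_eq_square algebra_simps)
  qed
  from quadratic_nonneg_imp_zero[OF this] show ?thesis by simp
qed

text \<open>Commuting roots satisfy (R + S)(R - S) = 0. For y = (R - S) x the two nonnegative values
  of the forms at \<open>y\<close> then sum to 0, so \<open>R\<close> and \<open>S\<close> both
  annihilate \<open>y\<close>, and |y|^2 = <x, (R - S) y> = 0.\<close>

lemma commuting_square_roots_eq:
  assumes R: "positive_op R" and S: "positive_op S"
    and comm: "\<And>x. R (S x) = S (R x)" and sq: "\<And>x. R (R x) = S (S x)"
  shows "R = S"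
proof
  fix x
  have RB: "R \<in> Bop" and SB: "S \<in> Bop" using R S by (auto simp: positive_op_def)
  define y where "y = R x - S x"
  have "R y + S y = 0"
    by (simp add: y_def Bop_diff[OF RB] Bop_diff[OF SB] comm sq)
  then have "Re (cinner (R y) y) + Re (cinner (S y) y) = 0"
    by (metis cinner_add_left cinner_zero_left plus_complex.simps(1) zero_complex.simps(1))
  with positive_op_Re[OF R, of y] positive_op_Re[OF S, of y]
  have "R y = 0" "S y = 0"
    by (auto intro!: positive_op_null[OF R] positive_op_null[OF S])
  then have "cinner y y = 0"
    using positive_op_selfadjoint[OF R, of x y] positive_op_selfadjoint[OF S, of x y]
    unfolding y_def by (simp add: cinner_diff_left)
  then show "R x = S x" by (simp add: cinner_self y_def)
qed

text \<open>Writing the root as \<open>I - Y\<close>, the equation \<open>(I - Y)\<^sup>2 = I - C\<close> becomes the fixed point equation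
  \<open>Y = (C + Y\<^sup>2) / 2\<close>. Its iteration from \<open>0\<close> is dominated in norm by the scalar iteration for \<open>C = 1\<close>,
  which increases and is bounded by \<open>1\<close>.\<close>

lemma square_root_exists:
  fixes C :: "'a::chilbert_space \<Rightarrow> 'a"
  assumes C: "C \<in> Bop" and sa: "\<And>x y. cinner (C x) y = cinner x (C y)"
    and contr: "\<And>x. norm (C x) \<le> norm x"
  obtains R where "positive_op R" "\<And>x. R (R x) = x - C x"
    "\<And>S x. S \<in> Bop \<Longrightarrow> (\<And>x. S (C x) = C (S x)) \<Longrightarrow> S (R x) = R (S x)"
proof -
  define Cb where "Cb = Blinfun C"
  have Cb: "blinfun_apply Cb = C"
    unfolding Cb_def by (rule bounded_linear_Blinfun_apply[OF Bop_bounded_linear[OF C]])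
  have nC: "norm Cb \<le> 1"
    by (rule norm_blinfun_bound) (auto simp: Cb contr)
  define Y where "Y = rec_nat (0 :: 'a \<Rightarrow>\<^sub>L 'a) (\<lambda>_ Z. (1/2) *\<^sub>R (Cb + (Z o\<^sub>L Z)))"
  have Y0: "Y 0 = 0" and YS: "\<And>n. Y (Suc n) = (1/2) *\<^sub>R (Cb + (Y n o\<^sub>L Y n))"
    by (simp_all add: Y_def)
  define q where "q = rec_nat (0::real) (\<lambda>_ s. (1 + s\<^sup>2) / 2)"
  have q0: "q 0 = 0" and qS: "\<And>n. q (Suc n) = (1 + (q n)\<^sup>2) / 2"
    by (simp_all add: q_def)
  have q: "0 \<le> q n \<and> q n \<le> 1" for n
    by (induction n) (auto simp: q0 qS power_le_one)
  have "q n \<le> q (Suc n)" for n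
    using zero_le_power2[of "1 - q n"] by (simp add: qS power2_eq_square algebra_simps)
  then have "incseq q" by (rule incseq_SucI)
  then have "convergent q"
    using q incseq_convergent[of q 1] convergent_def by blast
  then have "Cauchy q" by (rule convergent_Cauchy)
  have Yq: "norm (Y n) \<le> q n" for n
  proof (induction n)
    case (Suc n)
    have "norm (Y n o\<^sub>L Y n) \<le> norm (Y n) * norm (Y n)" by (rule norm_blinfun_compose)
    also have "\<dots> \<le> q n * q n" using Suc q by (intro mult_mono) auto
    finally show ?case
      using nC norm_triangle_ineq[of Cb "Y n o\<^sub>L Y n"] by (simp add: YS qS power2_eq_square)
  qed (simp add: Y0 q0)
  have step: "norm (Y (Suc n) - Y n) \<le> q (Suc n) - q n" for n
  proof (induction n)
    case 0
    then show ?case using nC by (simp add: YS Y0 qS q0 del: scaleR_add_right)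
  next
    case (Suc n)
    let ?D = "Y (Suc n) - Y n" and ?d = "q (Suc n) - q n"
    \<comment> \<open>The splitting Z Z - W W = Z (Z - W) + (Z - W) W. The scalar iteration obeys
      the same identity, so the bounds match term by term.\<close>
    have eq: "Y (Suc (Suc n)) - Y (Suc n) = (1/2) *\<^sub>R ((Y (Suc n) o\<^sub>L ?D) + (?D o\<^sub>L Y n))"
      by (rule blinfun_eqI)
        (simp add: YS[of "Suc n"] YS[of n, THEN arg_cong[where f = "\<lambda>Z. Cb + (Z o\<^sub>L Z)"]]
          blinfun.bilinear_simps algebra_simps, simp add: YS blinfun.bilinear_simps algebra_simps)
    have "norm (Y (Suc n) o\<^sub>L ?D) \<le> q (Suc n) * ?d"
      using norm_blinfun_compose[of "Y (Suc n)" ?D]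
        mult_mono[OF Yq[of "Suc n"] Suc] q[of "Suc n"] by simp
    moreover have "norm (?D o\<^sub>L Y n) \<le> ?d * q n"
      using norm_blinfun_compose[of ?D "Y n"] mult_mono[OF Suc Yq[of n]]
        order_trans[OF norm_ge_zero Suc] by simp
    ultimately have "norm (Y (Suc (Suc n)) - Y (Suc n)) \<le> (q (Suc n) * ?d + ?d * q n) / 2"
      unfolding eq using norm_triangle_ineq[of "Y (Suc n) o\<^sub>L ?D" "?D o\<^sub>L Y n"] by simp
    also have "\<dots> = q (Suc (Suc n)) - q (Suc n)"
      by (simp add: qS[of "Suc n"] qS[of n, symmetric] power2_eq_square algebra_simps)
        (simp add: qS power2_eq_square field_simps)
    finally show ?case .
  qed
  \<comment> \<open>The map s -> (1 + s^2) / 2 has slope 1 at its fixed point 1, so no geometric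
    rate is available; \<open>Y\<close> is Cauchy by comparison with \<open>q\<close>.\<close>
  have tele: "norm (Y n - Y m) \<le> q n - q m" if "m \<le> n" for m n
    using that
  proof (induction n rule: dec_induct)
    case (step n)
    then show ?case
      using norm_triangle_ineq[of "Y (Suc n) - Y n" "Y n - Y m"] \<open>\<And>n. norm (Y (Suc n) - Y n) \<le> q (Suc n) - q n\<close>[of n]
      by simp
  qed simp
  have "Cauchy Y"
  proof (rule CauchyI)
    fix e :: real assume "e > 0"
    then obtain M where M: "\<forall>m\<ge>M. \<forall>n\<ge>M. norm (q m - q n) < e"
      using \<open>Cauchy q\<close> CauchyD by blast
    have "norm (Y m - Y n) < e" if "m \<ge> M" "n \<ge> M" for m n
    proof (cases "m \<le> n")
      case True
      then show ?thesis using tele[OF True] M that by (smt (verit) norm_minus_commute real_norm_def)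
    next
      case False
      then show ?thesis using tele[of n m] M that by (smt (verit) nat_le_linear real_norm_def)
    qed
    then show "\<exists>M. \<forall>m\<ge>M. \<forall>n\<ge>M. norm (Y m - Y n) < e" by blast
  qed
  then obtain Z where Z: "Y \<longlonglongrightarrow> Z"
    using Cauchy_convergent_iff convergent_def by blast
  have Zx: "(\<lambda>n. Y n x) \<longlonglongrightarrow> Z x" for x
    by (intro tendsto_intros Z)
  have "(\<lambda>n. Y (Suc n) x) \<longlonglongrightarrow> (1/2) *\<^sub>R (C x + Z (Z x))" for x
    unfolding YS by (simp add: blinfun.bilinear_simps Cb) (intro tendsto_intros Z)
  then have fix_Z: "Z x = (1/2) *\<^sub>R (C x + Z (Z x))" for x
    using LIMSEQ_unique[OF LIMSEQ_Suc[OF Zx]] by blast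
  have "norm Z \<le> 1"
    using Yq q by (intro LIMSEQ_le_const2[OF tendsto_norm[OF Z]]) (meson order_trans)
  then have nZ: "norm (Z x) \<le> norm x" for x
    using norm_blinfun[of Z x] by (smt (verit) mult_left_le_one_le norm_ge_zero)
  have "cinner (Y n x) y = cinner x (Y n y)" for n x y
    by (induction n arbitrary: x y)
      (simp_all add: Y0 YS blinfun.bilinear_simps Cb cinner_scaleR_left cinner_scaleR_right
        cinner_add_left cinner_add_right sa)
  then have Zsa: "cinner (Z x) y = cinner x (Z y)" for x y
  proof -
    have "(\<lambda>n. cinner (Y n x) y) \<longlonglongrightarrow> cinner (Z x) y"
      by (rule bounded_linear.tendsto[OF bounded_linear_cinner_left Zx])
    moreover have "(\<lambda>n. cnj (cinner (Y n y) x)) \<longlonglongrightarrow> cnj (cinner (Z y) x)"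
      by (intro tendsto_cnj bounded_linear.tendsto[OF bounded_linear_cinner_left Zx])
    ultimately show ?thesis
      using \<open>\<And>n x y. cinner (Y n x) y = cinner x (Y n y)\<close>
      by (metis (no_types, lifting) LIMSEQ_unique cinner_commute ext)
  qed
  have ZB: "blinfun_apply Z \<in> Bop"
    by (rule adjoint_pair_Bop[OF Zsa, of 1]) (simp add: nZ)
  define R where "R x = x - Z x" for x
  have RB: "R \<in> Bop"
    using Bop_sub[OF Bop_id ZB] by (simp add: R_def[abs_def])
  show thesis
  proof (rule that[of R])
    have "cinner (R x) x \<in> \<real>\<^sub>\<ge>\<^sub>0" for x
    proof -
      have "cmod (cinner (Z x) x) \<le> (norm x)\<^sup>2"
        using cmod_cinner_le[of "Z x" x] mult_right_mono[OF nZ[of x] norm_ge_zero[of x]]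
        by (simp add: power2_eq_square)
      then have "Re (cinner (Z x) x) \<le> (norm x)\<^sup>2"
        using complex_Re_le_cmod order_trans by blast
      moreover have "cinner (Z x) x = cnj (cinner (Z x) x)"
        using Zsa[of x x] cinner_commute[of x "Z x"] by simp
      then have "Im (cinner (Z x) x) = 0"
        by (simp add: complex_eq_iff)
      ultimately show ?thesis
        by (simp add: R_def cinner_diff_left cinner_self complex_nonneg_Reals_iff)
    qed
    with RB show "positive_op R" by (simp add: positive_op_def)
    show "R (R x) = x - C x" for x
    proof -
      have "2 *\<^sub>R Z x = C x + Z (Z x)" using arg_cong[OF fix_Z[of x], of "\<lambda>v. 2 *\<^sub>R v"] by simp
      then show ?thesis
        by (simp add: R_def blinfun.bilinear_simps scaleR_2 algebra_simps)
    qed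
    fix S :: "'a \<Rightarrow> 'a" and x assume S: "S \<in> Bop" and SC: "\<And>x. S (C x) = C (S x)"
    have SR: "S (r *\<^sub>R x) = r *\<^sub>R S x" for r x
      using Bop_scaleC[OF S, of "complex_of_real r" x] by (simp add: scaleC_of_real)
    \<comment> \<open>Each \<open>Y n\<close> is a polynomial in \<open>C\<close>.\<close>
    have "S (Y n x) = Y n (S x)" for n x
      by (induction n arbitrary: x)
        (simp_all add: Y0 YS blinfun.bilinear_simps Cb S SC SR Bop_add[OF S] Bop_zero[OF S])
    moreover have "(\<lambda>n. S (Y n x)) \<longlonglongrightarrow> S (Z x)"
      by (rule bounded_linear.tendsto[OF Bop_bounded_linear[OF S] Zx])
    ultimately have "S (Z x) = Z (S x)"
      using LIMSEQ_unique[OF Zx] by simp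
    then show "S (R x) = R (S x)" by (simp add: R_def Bop_diff[OF S])
  qed
qed

text \<open>A second positive root commutes with its own square, hence with A*A, hence with the
  constructed root; then \<open>commuting_square_roots_eq\<close> applies.\<close>

lemma defect_op_unique_existence:
  assumes "contraction A"
  shows "\<exists>!R. positive_op R \<and> R \<circ> R = (\<lambda>x. x - adj A (A x))"
proof -
  have A: "A \<in> Bop" "\<And>x. norm (A x) \<le> norm x"
    and A': "adj A \<in> Bop" "\<And>x. norm (adj A x) \<le> norm x"
    using assms contraction_adj[OF assms] by (auto simp: contraction_iff)
  let ?C = "\<lambda>x. adj A (A x)"
  have C: "?C \<in> Bop" by (rule Bop_comp[OF A'(1) A(1)])
  obtain R where R: "positive_op R" "\<And>x. R (R x) = x - ?C x"
    and comm: "\<And>S x. S \<in> Bop \<Longrightarrow> (\<And>x. S (?C x) = ?C (S x)) \<Longrightarrow> S (R x) = R (S x)"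
    by (rule square_root_exists[OF C])
      (auto simp: adj_cinner[OF A(1)] adj_cinner'[OF A(1)] intro: order_trans[OF A'(2) A(2)])
  show ?thesis
  proof (rule ex1I[of _ R])
    show "positive_op R \<and> R \<circ> R = (\<lambda>x. x - ?C x)" using R by auto
    fix S assume "positive_op S \<and> S \<circ> S = (\<lambda>x. x - ?C x)"
    then have S: "positive_op S" "\<And>x. S (S x) = x - ?C x" by (auto simp: fun_eq_iff)
    then have SB: "S \<in> Bop" by (simp add: positive_op_def)
    have "S (x - ?C x) = S x - ?C (S x)" for x by (metis S(2))
    then have "S (?C x) = ?C (S x)" for x by (simp add: Bop_diff[OF SB])
    then have "S (R x) = R (S x)" for x by (rule comm[OF SB])
    then show "S = R"
      by (intro commuting_square_roots_eq S R) (simp_all add: S(2) R(2))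
  qed
qed

lemma
  assumes "contraction A"
  shows positive_defect_op: "positive_op (defect_op A)"
    and defect_op_defect_op: "defect_op A (defect_op A x) = x - adj A (A x)"
  using theI'[OF defect_op_unique_existence[OF assms]]
  by (auto simp: defect_op_def sqrt_op_def fun_eq_iff)

lemma defect_op_eqI:
  assumes "contraction A" "positive_op R" "\<And>x. R (R x) = x - adj A (A x)"
  shows "defect_op A = R"
  unfolding defect_op_def sqrt_op_def
  by (rule the1_equality[OF defect_op_unique_existence[OF assms(1)]]) (use assms in auto)

lemma defect_op_Bop: "contraction A \<Longrightarrow> defect_op A \<in> Bop"
  using positive_defect_op[of A] by (simp add: positive_op_def)

text \<open>The square of the norm involves only the square of the self-adjoint root, so it is known
  although the root is not.\<close>

lemma norm_defect_op:
  assumes "contraction A"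
  shows "(norm (defect_op A x))\<^sup>2 = (norm x)\<^sup>2 - (norm (A x))\<^sup>2"
proof -
  have A: "A \<in> Bop" using assms by (simp add: contraction_iff)
  have "cinner (defect_op A x) (defect_op A x) = cinner (x - adj A (A x)) x"
    using positive_op_selfadjoint[OF positive_defect_op[OF assms], of "defect_op A x" x]
    by (simp add: defect_op_defect_op assms)
  also have "\<dots> = complex_of_real ((norm x)\<^sup>2 - (norm (A x))\<^sup>2)"
    by (simp add: cinner_diff_left adj_cinner'[OF A] cinner_self)
  finally show ?thesis unfolding cinner_self of_real_eq_iff .
qed

lemma defect_op_in_defect_space: "defect_op A x \<in> defect_space A"
  unfolding defect_space_def by (rule subsetD[OF closure_subset]) simp

subsection \<open>Partial isometries and Shmul'yan domination\<close>

lemma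
  assumes "partial_isometry T"
  shows partial_isometry_Bop: "T \<in> Bop"
    and partial_isometry_eq: "T (adj T (T x)) = T x"
  using assms by (auto simp: partial_isometry_def fun_eq_iff)

lemma partial_isometry_adj_eq:
  assumes "partial_isometry T"
  shows "adj T (T (adj T y)) = adj T y"
proof (rule cinner_eqI_right)
  note T = partial_isometry_Bop[OF assms]
  fix x
  have "cinner x (adj T (T (adj T y))) = cinner (adj T (T x)) (adj T y)"
    by (metis adj_cinner[OF T] adj_cinner'[OF T])
  also have "\<dots> = cinner (T (adj T (T x))) y"
    by (simp only: adj_cinner[OF T])
  finally show "cinner x (adj T (T (adj T y))) = cinner x (adj T y)"
    by (simp add: partial_isometry_eq[OF assms] adj_cinner[OF T])
qed

lemma partial_isometry_adj:
  assumes "partial_isometry T"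
  shows "partial_isometry (adj T)"
  using partial_isometry_adj_eq[OF assms] partial_isometry_Bop[OF assms]
  by (auto simp: partial_isometry_def adj_Bop adj_adj fun_eq_iff)

text \<open>T*Tx and Tx have equal norms, and |Tx|^2 = <T*Tx, x>; Cauchy-Schwarz does the
  rest.\<close>

lemma partial_isometry_contraction:
  assumes "partial_isometry T"
  shows "contraction T"
proof -
  note T = partial_isometry_Bop[OF assms]
  have "norm (T x) \<le> norm x" for x
  proof -
    have 1: "cinner (adj T (T x)) x = complex_of_real ((norm (T x))\<^sup>2)"
      by (simp add: adj_cinner'[OF T] cinner_self)
    have "cinner (adj T (T x)) (adj T (T x)) = cinner (T x) (T x)"
      by (simp only: adj_cinner'[OF T] partial_isometry_eq[OF assms])
    then have "(norm (adj T (T x)))\<^sup>2 = (norm (T x))\<^sup>2"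
      unfolding cinner_self of_real_eq_iff .
    then have "norm (adj T (T x)) = norm (T x)" by simp
    then have "(norm (T x))\<^sup>2 \<le> norm (T x) * norm x"
      using cmod_cinner_le[of "adj T (T x)" x] 1 by (simp add: norm_power)
    then show ?thesis
      by (cases "T x = 0") (auto simp: power2_eq_square)
  qed
  with T show ?thesis by (simp add: contraction_iff)
qed

text \<open>A positive idempotent is its own positive square root.\<close>

lemma defect_op_partial_isometry:
  assumes "partial_isometry T"
  shows "defect_op T = (\<lambda>x. x - adj T (T x))"
proof (rule defect_op_eqI)
  note T = partial_isometry_Bop[OF assms]
  let ?P = "\<lambda>x. x - adj T (T x)"
  show c: "contraction T" by (rule partial_isometry_contraction[OF assms])
  have P: "?P \<in> Bop" by (rule Bop_sub[OF Bop_id Bop_comp[OF adj_Bop[OF T] T]])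
  have "cinner (?P x) x \<in> \<real>\<^sub>\<ge>\<^sub>0" for x
  proof -
    have "cinner (?P x) x = complex_of_real ((norm x)\<^sup>2 - (norm (T x))\<^sup>2)"
      by (simp add: cinner_diff_left adj_cinner'[OF T] cinner_self)
    moreover have "(norm (T x))\<^sup>2 \<le> (norm x)\<^sup>2"
      using c by (intro power_mono) (auto simp: contraction_iff)
    ultimately show ?thesis by (simp add: complex_nonneg_Reals_iff)
  qed
  with P show "positive_op ?P" by (simp add: positive_op_def)
  show "?P (?P x) = ?P x" for x
    by (simp add: Bop_diff[OF T] partial_isometry_eq[OF assms] Bop_zero[OF adj_Bop[OF T]])
qed

text \<open>The range of the projection I - T*T is a kernel, so taking the closure adds
  nothing.\<close>

lemma defect_space_partial_isometry:
  assumes "partial_isometry T"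
  shows "defect_space T = {x. T x = 0}"
proof -
  note T = partial_isometry_Bop[OF assms]
  have "range (defect_op T) = {x. T x = 0}"
  proof (intro set_eqI iffI)
    fix x assume "x \<in> {x. T x = 0}"
    then have "x = defect_op T x"
      by (simp add: defect_op_partial_isometry[OF assms] Bop_zero[OF adj_Bop[OF T]])
    then show "x \<in> range (defect_op T)" by blast
  qed (auto simp: defect_op_partial_isometry[OF assms] Bop_diff[OF T] partial_isometry_eq[OF assms])
  moreover have "closed {x. T x = 0}"
    by (intro closed_Collect_eq continuous_on_const
        linear_continuous_on Bop_bounded_linear[OF T])
  ultimately show ?thesis by (simp add: defect_space_def)
qed

lemma defect_op_adj_partial_isometry:
  "partial_isometry T \<Longrightarrow> defect_op (adj T) = (\<lambda>y. y - T (adj T y))"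
  by (simp add: defect_op_partial_isometry partial_isometry_adj adj_adj partial_isometry_Bop)

text \<open>The two equations say that \<open>B - A\<close> maps into the kernel of A* and vanishes
  on the initial space of \<open>A\<close>. Free of defect operators, they can later be compared
  pointwise with conditions on the symbol.\<close>

lemma partial_isometry_dominates_iff:
  assumes A: "partial_isometry A"
  shows "shmulyan_dominates A B \<longleftrightarrow> contraction B \<and>
    (\<forall>h. adj A (B h) = adj A (A h)) \<and> (\<forall>h. B (adj A (A h)) = A h)"
proof -
  note AB = partial_isometry_Bop[OF A] and A'B = adj_Bop[OF partial_isometry_Bop[OF A]]
  note simps = defect_op_partial_isometry[OF A] defect_op_adj_partial_isometry[OF A]
    defect_space_partial_isometry[OF A] defect_space_partial_isometry[OF partial_isometry_adj[OF A]]
    partial_isometry_eq[OF A] partial_isometry_adj_eq[OF A]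
    Bop_diff[OF AB] Bop_diff[OF A'B] Bop_add[OF AB] Bop_add[OF A'B]
    Bop_zero[OF AB] Bop_zero[OF A'B]
  show ?thesis
  proof
    assume "shmulyan_dominates A B"
    then obtain X where B: "contraction B"
      and X: "X \<in> bounded_ops (defect_space A) (defect_space (adj A))"
      and eq: "B = (\<lambda>h. A h + defect_op (adj A) (X (defect_op A h)))"
      unfolding shmulyan_dominates_def by blast
    \<comment> \<open>\<open>defect_op A\<close> kills \<open>adj A (A h)\<close>; with
      \<open>X 0 = 0\<close> this makes \<open>B\<close> agree with \<open>A\<close> there.\<close>
    have "0 \<in> defect_space A" by (simp add: simps)
    with X have "X (0 *\<^sub>C 0) = 0 *\<^sub>C X 0"
      unfolding bounded_ops_def by blast
    then have "X 0 = 0" by simp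
    then show "contraction B \<and> (\<forall>h. adj A (B h) = adj A (A h)) \<and> (\<forall>h. B (adj A (A h)) = A h)"
      using B unfolding eq by (simp add: simps)
  next
    assume r: "contraction B \<and> (\<forall>h. adj A (B h) = adj A (A h)) \<and> (\<forall>h. B (adj A (A h)) = A h)"
    then have B: "B \<in> Bop" "\<And>x. norm (B x) \<le> norm x" by (auto simp: contraction_iff)
    let ?S = "{x. A x = 0}"
    \<comment> \<open>The first equation makes \<open>B\<close> map the kernel of \<open>A\<close>
      into the kernel of A*, so \<open>B\<close> itself can be the middle factor.\<close>
    define X where "X = restrict B ?S"
    have "X \<in> bounded_ops ?S {y. adj A y = 0}"
      using B r by (auto simp: bounded_ops_def X_def Bop_add[OF B(1)] Bop_scaleC[OF B(1)]
          Bop_add[OF AB] Bop_scaleC[OF AB] Bop_zero[OF A'B] intro!: exI[of _ 1])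
    moreover have "B = (\<lambda>h. A h + defect_op (adj A) (X (defect_op A h)))"
      using r by (simp add: X_def simps Bop_diff[OF B(1)] fun_eq_iff)
    ultimately show "shmulyan_dominates A B"
      unfolding shmulyan_dominates_def defect_space_partial_isometry[OF A]
        defect_space_partial_isometry[OF partial_isometry_adj[OF A]]
      using r partial_isometry_contraction[OF A] by blast
  qed
qed

lemma shmulyan_dominates_strict_bound:
  assumes "shmulyan_dominates B A"
  obtains c where "0 \<le> c" "c < 1" "\<And>h. A h = 0 \<Longrightarrow> norm (B h) \<le> c * norm h"
proof -
  obtain X where B: "contraction B" and A: "contraction A"
    and X: "X \<in> bounded_ops (defect_space B) (defect_space (adj B))"
    and eq: "A = (\<lambda>h. B h + defect_op (adj B) (X (defect_op B h)))"
    using assms unfolding shmulyan_dominates_def by blast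
  obtain K1 where K1: "0 \<le> K1" "\<And>y. norm (defect_op (adj B) y) \<le> K1 * norm y"
    using Bop_bounded[OF defect_op_Bop[OF contraction_adj[OF B]]] by blast
  obtain K2 where K2: "\<And>x. x \<in> defect_space B \<Longrightarrow> norm (X x) \<le> K2 * norm x"
    using X unfolding bounded_ops_def by blast
  \<comment> \<open>The domination gives |Bh|^2 <= k (|h|^2 - |Bh|^2), and solving for |Bh|^2
    produces the factor k / (1 + k). \<open>K2\<close> has no known sign, but \<open>k\<close> is a
    square.\<close>
  define k where "k = (K1 * K2)\<^sup>2"
  have k: "k \<ge> 0" by (simp add: k_def)
  show thesis
  proof (rule that[of "sqrt (k / (1 + k))"])
    show "0 \<le> sqrt (k / (1 + k))" "sqrt (k / (1 + k)) < 1"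
      using k by (auto simp: divide_less_eq)
    fix h assume "A h = 0"
    then have "B h = - defect_op (adj B) (X (defect_op B h))"
      using fun_cong[OF eq, of h] by (simp add: eq_neg_iff_add_eq_0)
    then have "norm (B h) \<le> K1 * norm (X (defect_op B h))" using K1(2) by simp
    also have "\<dots> \<le> K1 * (K2 * norm (defect_op B h))"
      by (intro mult_left_mono K1 K2 defect_op_in_defect_space)
    finally have "(norm (B h))\<^sup>2 \<le> (K1 * (K2 * norm (defect_op B h)))\<^sup>2"
      by (intro power_mono) auto
    also have "\<dots> = k * ((norm h)\<^sup>2 - (norm (B h))\<^sup>2)"
      unfolding norm_defect_op[OF B, symmetric] by (simp add: k_def power_mult_distrib)
    finally have "(norm (B h))\<^sup>2 \<le> k / (1 + k) * (norm h)\<^sup>2"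
      using k by (simp add: field_simps)
    then have "norm (B h) \<le> sqrt (k / (1 + k) * (norm h)\<^sup>2)"
      by (rule real_le_rsqrt)
    then show "norm (B h) \<le> sqrt (k / (1 + k)) * norm h"
      unfolding real_sqrt_mult by simp
  qed
qed

text \<open>The equation x = y + K x is solved by Banach's fixed point theorem. Injectivity of I - K
  then makes the solution map linear and a left inverse as well.\<close>

lemma neumann_inverse:
  fixes K :: "'a::chilbert_space \<Rightarrow> 'a"
  assumes K: "K \<in> Bop" and c: "c < 1" "0 \<le> c" and Kc: "\<And>x. norm (K x) \<le> c * norm x"
  obtains N where "N \<in> Bop" "\<And>y. N y - K (N y) = y" "\<And>x. N (x - K x) = x"
proof -
  have inj: "x = 0" if "x - K x = 0" for x
  proof -
    have "K x = x" using that by (metis eq_iff_diff_eq_0)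
    then have "norm x \<le> c * norm x" using Kc[of x] by simp
    then show ?thesis using c mult_le_cancel_right1[of "norm x" c] by (auto simp: not_le)
  qed
  have "\<exists>x. y + K x = x" for y
  proof -
    have "\<exists>!x. y + K x = x"
    proof (rule banach_fix_type[OF c(2,1)], intro allI)
      fix u v
      show "dist (y + K u) (y + K v) \<le> c * dist u v"
        using Kc[of "u - v"] by (simp add: dist_norm Bop_diff[OF K])
    qed
    then show ?thesis by blast
  qed
  then obtain N where N: "\<And>y. y + K (N y) = N y" by metis
  have NK: "N y - K (N y) = y" for y using N[of y] by (simp add: algebra_simps)
  have unique: "N y = x" if "x - K x = y" for x y
  proof -
    have "(N y - x) - K (N y - x) = (N y - K (N y)) - (x - K x)"
      by (simp add: Bop_diff[OF K])
    then have "(N y - x) - K (N y - x) = 0" by (simp only: NK that diff_self)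
    from inj[OF this] show ?thesis by simp
  qed
  have "N (x + y) = N x + N y" for x y
    by (rule unique) (simp add: Bop_add[OF K] add_diff_add NK)
  moreover have "N (a *\<^sub>C x) = a *\<^sub>C N x" for a x
    by (rule unique) (simp add: Bop_scaleC[OF K] NK flip: scaleC_diff_right)
  moreover have "norm (N x) \<le> (1 / (1 - c)) * norm x" for x
  proof -
    have "norm (N x) \<le> norm x + c * norm (N x)"
      using N[of x] norm_triangle_ineq[of x "K (N x)"] Kc[of "N x"] by simp
    then show ?thesis using c by (simp add: field_simps)
  qed
  ultimately have "N \<in> Bop" unfolding bounded_ops_def by blast
  then show thesis using NK unique that by blast
qed

text \<open>With \<open>B = A + C\<close> and \<open>P\<close>, \<open>Q\<close> the defect projections of \<open>A\<close>, one has \<open>C = QCP\<close>,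
  \<open>D\<^sub>B\<^sup>2 = (I - C\<^sup>*C)P\<close> and \<open>D\<^bsub>B*\<^esub>\<^sup>2 = Q(I - CC\<^sup>*)\<close>. Hence
  \<open>C = D\<^bsub>B*\<^esub>\<^sup>2 (I - CC\<^sup>*)\<^sup>-\<^sup>1 C (I - C\<^sup>*C)\<^sup>-\<^sup>1 D\<^sub>B\<^sup>2\<close>, from which the operator witnessing
  domination is read off.\<close>

lemma dominates_partial_isometryI:
  assumes A: "partial_isometry A" and dom: "shmulyan_dominates A B"
    and c: "c < 1" "0 \<le> c" and Bc: "\<And>h. A h = 0 \<Longrightarrow> norm (B h) \<le> c * norm h"
  shows "shmulyan_dominates B A"
proof -
  note AB = partial_isometry_Bop[OF A]
  note A'B = adj_Bop[OF AB]
  have B: "contraction B" and B1: "\<And>h. adj A (B h) = adj A (A h)"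
    and B2: "\<And>h. B (adj A (A h)) = A h"
    using dom by (auto simp: partial_isometry_dominates_iff[OF A])
  then have BB: "B \<in> Bop" by (simp add: contraction_iff)
  note B'B = adj_Bop[OF BB]
  define C where "C h = B h - A h" for h
  have CB: "C \<in> Bop" unfolding C_def[abs_def] by (rule Bop_sub[OF BB AB])
  note C'B = adj_Bop[OF CB]
  have CP: "C h = B (h - adj A (A h))" for h
    by (simp add: C_def Bop_diff[OF BB] B2)
  have nC: "norm (C h) \<le> c * norm h" for h
  proof -
    have "norm (C h) \<le> c * norm (h - adj A (A h))"
      unfolding CP by (rule Bc) (simp add: Bop_diff[OF AB] partial_isometry_eq[OF A])
    also have "norm (h - adj A (A h)) \<le> norm h"
    proof (rule power2_le_imp_le)
      show "(norm (h - adj A (A h)))\<^sup>2 \<le> (norm h)\<^sup>2"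
        using norm_defect_op[OF partial_isometry_contraction[OF A], of h]
        by (simp add: defect_op_partial_isometry[OF A])
    qed simp
    finally show ?thesis using c by (simp add: mult_left_mono)
  qed
  have nC': "norm (adj C h) \<le> c * norm h" for h
    by (rule norm_adj_le[OF CB nC c(2)])
  \<comment> \<open>These four identities express the orthogonality of ranges and of initial spaces;
    they remove all mixed terms from B*B and BB*.\<close>
  have A'C: "adj A (C h) = 0" for h by (simp add: C_def Bop_diff[OF A'B] B1)
  have CA': "C (adj A y) = 0" for y
    using CP[of "adj A y"] by (simp add: partial_isometry_adj_eq[OF A] Bop_zero[OF BB])
  have C'A: "adj C (A h) = 0" for h
    by (rule cinner_eqI) (simp add: adj_cinner'[OF CB] adj_cinner[OF AB] A'C)
  have AC': "A (adj C y) = 0" for y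
    by (rule cinner_eqI) (simp add: adj_cinner[OF AB] adj_cinner'[OF CB] CA')
  have B_eq: "B h = A h + C h" for h by (simp add: C_def)
  have "C = (\<lambda>h. B h - A h)" by (simp add: C_def[abs_def])
  then have adjB: "adj B y = adj A y + adj C y" for y
    using adj_sub[OF BB AB] by simp
  let ?D = "defect_op B" and ?D' = "defect_op (adj B)"
  have D2: "?D (?D h) = h - adj A (A h) - adj C (C h)" for h
    by (simp add: defect_op_defect_op[OF B] adjB B_eq Bop_add[OF A'B] Bop_add[OF C'B] A'C C'A)
  have D'2: "?D' (?D' y) = y - A (adj A y) - C (adj C y)" for y
    by (simp add: defect_op_defect_op[OF contraction_adj[OF B]] adj_adj[OF BB] adjB B_eq
        Bop_add[OF AB] Bop_add[OF CB] AC' CA')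
  have c2: "c * c < 1" using c mult_strict_mono[of c 1 c 1] by simp
  have "norm (adj C (C h)) \<le> c * (c * norm h)" for h
    by (rule order_trans[OF nC' mult_left_mono[OF nC c(2)]])
  then have nC'C: "norm (adj C (C h)) \<le> c * c * norm h" for h by (simp add: mult.assoc)
  have "norm (C (adj C y)) \<le> c * (c * norm y)" for y
    by (rule order_trans[OF nC mult_left_mono[OF nC' c(2)]])
  then have nCC': "norm (C (adj C y)) \<le> c * c * norm y" for y by (simp add: mult.assoc)
  have c0: "0 \<le> c * c" by simp
  obtain N where N: "N \<in> Bop" "\<And>x. N (x - adj C (C x)) = x"
    by (rule neumann_inverse[OF Bop_comp[OF C'B CB] c2 c0 nC'C]) blast
  obtain N' where N': "N' \<in> Bop" "\<And>y. N' y - C (adj C (N' y)) = y"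
    by (rule neumann_inverse[OF Bop_comp[OF CB C'B] c2 c0 nCC']) blast
  \<comment> \<open>With P = I - A*A the squared defect operator is (I - C*C) P, which
    \<open>N\<close> turns into \<open>P\<close>; and C P = C.\<close>
  have CN: "C (N (?D (?D h))) = C h" for h
  proof -
    have "?D (?D h) = (h - adj A (A h)) - adj C (C (h - adj A (A h)))"
      unfolding D2 by (simp add: Bop_diff[OF CB] CA')
    then have "C (N (?D (?D h))) = C (h - adj A (A h))" by (simp only: N(2))
    then show ?thesis by (simp add: Bop_diff[OF CB] CA')
  qed
  have N'C: "?D' (?D' (N' (C h))) = C h" for h
  proof -
    have "adj A (N' (C h)) = adj A (N' (C h) - C (adj C (N' (C h))))"
      by (simp add: Bop_diff[OF A'B] A'C)
    then have "adj A (N' (C h)) = 0" by (simp add: N'(2) A'C)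
    then show ?thesis using N'(2)[of "C h"] by (simp add: D'2 Bop_zero[OF AB])
  qed
  \<comment> \<open>The sign arises because \<open>B\<close> must be corrected by \<open>- C\<close>
    to give \<open>A\<close>.\<close>
  define Y where "Y k = - ?D' (N' (C (N (?D k))))" for k
  note DB = defect_op_Bop[OF B] and D'B = defect_op_Bop[OF contraction_adj[OF B]]
  have YB: "Y \<in> Bop"
    unfolding Y_def[abs_def]
    by (rule Bop_uminus[OF Bop_comp[OF D'B Bop_comp[OF N'(1) Bop_comp[OF CB Bop_comp[OF N(1) DB]]]]])
  define S where "S = defect_space B"
  \<comment> \<open>The restriction of \<open>Y\<close> is \<open>undefined\<close> off
    \<open>S\<close>, so its linearity requires \<open>S\<close> to be a subspace.\<close>
  have sp: "x + y \<in> S" "a *\<^sub>C x \<in> S" if "x \<in> S" "y \<in> S" for x y a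
  proof -
    obtain f where f: "\<And>n. f n \<in> range ?D" "f \<longlonglongrightarrow> x"
      using \<open>x \<in> S\<close> unfolding S_def defect_space_def closure_sequential by blast
    obtain g where g: "\<And>n. g n \<in> range ?D" "g \<longlonglongrightarrow> y"
      using \<open>y \<in> S\<close> unfolding S_def defect_space_def closure_sequential by blast
    have 1: "f n + g n \<in> range ?D" and 2: "a *\<^sub>C f n \<in> range ?D" for n
      using f(1)[of n] g(1)[of n] by (auto simp flip: Bop_add[OF DB] Bop_scaleC[OF DB])
    show "x + y \<in> S"
      unfolding S_def defect_space_def closure_sequential
      by (intro exI[of _ "\<lambda>n. f n + g n"] conjI allI tendsto_add f(2) g(2) 1)
    show "a *\<^sub>C x \<in> S"
      unfolding S_def defect_space_def closure_sequential
      by (intro exI[of _ "\<lambda>n. a *\<^sub>C f n"] conjI allI 2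
          bounded_linear.tendsto[OF bounded_linear_scaleC f(2)])
  qed
  have YS: "Y x \<in> defect_space (adj B)" for x
    using defect_op_in_defect_space[of "adj B" "- N' (C (N (?D x)))"]
    by (simp add: Y_def Bop_minus[OF D'B])
  obtain M where M: "\<And>x. norm (Y x) \<le> M * norm x" using Bop_bounded[OF YB] by blast
  have "restrict Y S \<in> bounded_ops S (defect_space (adj B))"
    using sp YS M by (auto simp: bounded_ops_def Bop_add[OF YB] Bop_scaleC[OF YB]
        intro!: exI[of _ M])
  moreover have "A = (\<lambda>h. B h + ?D' (restrict Y S (?D h)))"
  proof
    fix h
    have "?D h \<in> S" by (simp add: S_def defect_op_in_defect_space)
    then have "?D' (restrict Y S (?D h)) = - ?D' (?D' (N' (C (N (?D (?D h))))))"
      by (simp add: Y_def Bop_minus[OF D'B])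
    also have "\<dots> = - C h" unfolding CN N'C by simp
    finally show "A h = B h + ?D' (restrict Y S (?D h))" by (simp add: C_def)
  qed
  ultimately show ?thesis
    using B partial_isometry_contraction[OF A] unfolding shmulyan_dominates_def S_def by blast
qed

section \<open>Toeplitz operators of bounded analytic functions\<close>

lemma cinner_sum_left: "cinner (sum f A) y = (\<Sum>i\<in>A. cinner (f i) (y::'a::chilbert_space))"
  by (induction A rule: infinite_finite_induct) (simp_all add: cinner_add_left)

lemma cinner_sum_right: "cinner y (sum f A) = (\<Sum>i\<in>A. cinner (y::'a::chilbert_space) (f i))"
  by (induction A rule: infinite_finite_induct) (simp_all add: cinner_add_right)

lemma scaleC_sum_right: "c *\<^sub>C sum f A = (\<Sum>i\<in>A. c *\<^sub>C (f i :: 'a::chilbert_space))"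
  by (induction A rule: infinite_finite_induct) (simp_all add: scaleC_add_right)

lemma scaleC_sum_left: "sum f A *\<^sub>C x = (\<Sum>i\<in>A. f i *\<^sub>C (x :: 'a::chilbert_space))"
  by (induction A rule: infinite_finite_induct) (simp_all add: scaleC_add_left)

text \<open>Controls both the aliasing error in \<open>fourier_coefficient_tendsto\<close> and the
  truncation error in \<open>taylor_fun_conv\<close>: in each, the first \<open>N\<close> terms
  cancel and the others decay geometrically.\<close>

lemma sums_tail_norm_le:
  fixes e :: "nat \<Rightarrow> 'a::banach"
  assumes "e sums s" and "\<And>n. n < N \<Longrightarrow> e n = 0" and "\<And>n. norm (e n) \<le> B * r ^ n"
    and "0 \<le> r" "r < 1"
  shows "norm s \<le> B / (1 - r) * r ^ N"
proof -
  have s: "(\<lambda>n. e (n + N)) sums s"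
    using assms(1,2) by (simp add: sums_zero_iff_shift)
  have g: "(\<lambda>n. B * r ^ N * r ^ n) sums (B * r ^ N * (1 / (1 - r)))"
    using assms(4,5) by (intro sums_mult geometric_sums) simp
  have "norm (suminf (\<lambda>n. e (n + N))) \<le> (\<Sum>n. B * r ^ N * r ^ n)"
  proof (rule norm_suminf_le)
    show "norm (e (n + N)) \<le> B * r ^ N * r ^ n" for n
      using assms(3)[of "n + N"] by (simp add: power_add mult_ac)
  qed (use g in \<open>rule sums_summable\<close>)
  then show ?thesis
    using s g by (simp add: sums_iff)
qed


subsection \<open>Discrete Fourier transform\<close>

definition unit_root :: "nat \<Rightarrow> complex" where
  "unit_root N = cis (2 * pi / real N)"

lemma norm_unit_root [simp]: "cmod (unit_root N) = 1"
  by (simp add: unit_root_def)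

lemma unit_root_power_eq_1: "N > 0 \<Longrightarrow> unit_root N ^ m = 1 \<longleftrightarrow> N dvd m"
proof -
  assume "N > 0"
  moreover have "unit_root N ^ m = exp (2 * of_real pi * \<i> * of_nat m / of_nat N)"
    unfolding unit_root_def Complex.DeMoivre by (simp add: cis_conv_exp mult_ac)
  ultimately show ?thesis using complex_root_unity_eq_1[of N m] by simp
qed

lemma sum_unit_root_powers:
  assumes "N > 0"
  shows "(\<Sum>k<N. unit_root N ^ (k * m)) = (if N dvd m then of_nat N else 0)"
proof -
  have eq: "(\<Sum>k<N. unit_root N ^ (k * m)) = (\<Sum>k<N. (unit_root N ^ m) ^ k)"
    by (simp add: power_mult[symmetric] mult.commute)
  show ?thesis
  proof (cases "N dvd m")
    case True
    then have "unit_root N ^ m = 1" using unit_root_power_eq_1[OF assms] by blast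
    then show ?thesis using True by (simp add: eq)
  next
    case False
    then have "unit_root N ^ m \<noteq> 1" using unit_root_power_eq_1[OF assms] by blast
    then have "(\<Sum>k<N. (unit_root N ^ m) ^ k) = ((unit_root N ^ m) ^ N - 1) / (unit_root N ^ m - 1)"
      by (rule geometric_sum)
    also have "(unit_root N ^ m) ^ N = 1"
      using unit_root_power_eq_1[OF assms, of "m * N"] by (simp add: power_mult)
    finally show ?thesis using False by (simp add: eq)
  qed
qed

text \<open>The exponent \<open>m + N - j\<close> represents m - j modulo \<open>N\<close> without
  truncated subtraction. \<open>m\<close> may exceed \<open>N\<close>, because the transform is
  applied to infinite power series.\<close>

lemma sum_unit_root_orthogonal:
  assumes "j < N"
  shows "(\<Sum>k<N. cnj (unit_root N ^ (k * j)) * unit_root N ^ (k * m))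
    = (if N dvd m + N - j then of_nat N else 0)"
proof -
  have "cnj (unit_root N ^ (k * j)) * unit_root N ^ (k * m) = unit_root N ^ (k * (m + N - j))" for k
  proof -
    have "unit_root N ^ (k * j) * unit_root N ^ (k * (m + N - j)) = unit_root N ^ (k * m + k * N)"
      using assms by (simp flip: power_add distrib_left)
    also have "\<dots> = unit_root N ^ (k * m)"
      using unit_root_power_eq_1[of N "k * N"] assms by (simp add: power_add)
    finally have "cnj (unit_root N ^ (k * j)) * unit_root N ^ (k * m)
        = (unit_root N ^ (k * j) * cnj (unit_root N ^ (k * j))) * unit_root N ^ (k * (m + N - j))"
      by (simp add: mult_ac)
    also have "unit_root N ^ (k * j) * cnj (unit_root N ^ (k * j)) = 1"
      using complex_norm_square[of "unit_root N ^ (k * j)"]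
      by (simp add: norm_power del: complex_cnj_power)
    finally show ?thesis by simp
  qed
  then show ?thesis using sum_unit_root_powers[of N "m + N - j"] assms by simp
qed

text \<open>Kept abstract in the matrix \<open>e\<close>, as it is applied to the Fourier matrix and
  to its conjugate.\<close>

lemma parseval:
  fixes v :: "nat \<Rightarrow> 'a::chilbert_space" and e :: "nat \<Rightarrow> nat \<Rightarrow> complex"
  assumes "\<And>i j. i < N \<Longrightarrow> j < N \<Longrightarrow> (\<Sum>k<N. e k i * cnj (e k j)) = (if i = j then of_nat N else 0)"
  shows "(\<Sum>k<N. (norm (\<Sum>j<N. e k j *\<^sub>C v j))\<^sup>2) = real N * (\<Sum>j<N. (norm (v j))\<^sup>2)"
proof -
  have "complex_of_real (\<Sum>k<N. (norm (\<Sum>j<N. e k j *\<^sub>C v j))\<^sup>2)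
      = (\<Sum>k<N. cinner (\<Sum>i<N. e k i *\<^sub>C v i) (\<Sum>j<N. e k j *\<^sub>C v j))"
    by (simp add: cinner_self)
  also have "\<dots> = (\<Sum>k<N. \<Sum>i<N. \<Sum>j<N. (e k i * cnj (e k j)) * cinner (v i) (v j))"
    unfolding cinner_sum_left
    by (simp add: cinner_sum_right cinner_scaleC_left cinner_scaleC_right sum_distrib_left mult_ac)
  also have "\<dots> = (\<Sum>i<N. \<Sum>j<N. \<Sum>k<N. (e k i * cnj (e k j)) * cinner (v i) (v j))"
    by (subst sum.swap) (intro sum.cong refl sum.swap)
  also have "\<dots> = (\<Sum>i<N. \<Sum>j<N. (if i = j then of_nat N else 0) * cinner (v i) (v j))"
    by (intro sum.cong refl) (simp add: assms flip: sum_distrib_right)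
  also have "\<dots> = (\<Sum>i<N. \<Sum>j<N. if i = j then of_nat N * cinner (v i) (v j) else 0)"
    by (intro sum.cong refl) simp
  also have "\<dots> = (\<Sum>i<N. of_nat N * cinner (v i) (v i))"
    by (intro sum.cong refl) (simp add: sum.delta)
  also have "\<dots> = complex_of_real (real N * (\<Sum>j<N. (norm (v j))\<^sup>2))"
    by (simp add: cinner_self sum_distrib_left)
  finally show ?thesis unfolding of_real_eq_iff .
qed

lemma dvd_add_diff_iff:
  fixes i j N :: nat
  assumes "i < N" "j < N"
  shows "N dvd i + N - j \<longleftrightarrow> i = j"
proof
  assume "N dvd i + N - j"
  then obtain q where q: "i + N - j = N * q" by (auto simp: dvd_def)
  have "q \<noteq> 0" using q assms by (intro notI) simp
  moreover have "q < 2"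
  proof (rule ccontr)
    assume "\<not> q < 2"
    then have "N * 2 \<le> N * q" by simp
    moreover have "i + N - j < N * 2" using assms by linarith
    ultimately show False using q by linarith
  qed
  ultimately have "q = 1" by simp
  with q assms show "i = j" by simp
qed simp

lemma parseval_unit_root:
  fixes v :: "nat \<Rightarrow> 'a::chilbert_space"
  shows "(\<Sum>k<N. (norm (\<Sum>j<N. unit_root N ^ (k * j) *\<^sub>C v j))\<^sup>2) = real N * (\<Sum>j<N. (norm (v j))\<^sup>2)"
proof (rule parseval)
  fix i j assume "i < N" "j < N"
  then show "(\<Sum>k<N. unit_root N ^ (k * i) * cnj (unit_root N ^ (k * j))) = (if i = j then of_nat N else 0)"
    using sum_unit_root_orthogonal[of j N i] by (simp add: dvd_add_diff_iff mult.commute)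
qed

lemma parseval_unit_root_cnj:
  fixes v :: "nat \<Rightarrow> 'a::chilbert_space"
  shows "(\<Sum>j<N. (norm (\<Sum>k<N. cnj (unit_root N ^ (k * j)) *\<^sub>C v k))\<^sup>2) = real N * (\<Sum>k<N. (norm (v k))\<^sup>2)"
proof (rule parseval)
  fix i j assume "i < N" "j < N"
  then show "(\<Sum>k<N. cnj (unit_root N ^ (i * k)) * cnj (cnj (unit_root N ^ (j * k)))) = (if i = j then of_nat N else 0)"
    using sum_unit_root_orthogonal[of i N j] by (auto simp: dvd_add_diff_iff mult.commute)
qed


subsection \<open>Multiplication by an operator-valued function\<close>

text \<open>Weak analyticity is enough to use scalar function theory. The bound is a parameter
  because the locale is instantiated with 1 for \<open>G\<close>, with a strict constant for
  \<open>G - T\<close>, and with arbitrary bounds for constant symbols.\<close>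

locale bounded_analytic =
  fixes F :: "complex \<Rightarrow> 'a::chilbert_space \<Rightarrow> 'b::chilbert_space" and K :: real
  assumes K: "0 \<le> K"
    and F_Bop: "z \<in> ball 0 1 \<Longrightarrow> F z \<in> Bop"
    and F_bound: "z \<in> ball 0 1 \<Longrightarrow> norm (F z x) \<le> K * norm x"
    and F_holo: "(\<lambda>z. cinner (F z x) y) holomorphic_on ball 0 1"
begin

section \<open>Taylor coefficients of the symbol\<close>

definition scalar_coeff :: "nat \<Rightarrow> 'a \<Rightarrow> 'b \<Rightarrow> complex" where
  "scalar_coeff n x y = (deriv ^^ n) (\<lambda>z. cinner (F z x) y) 0 / fact n"

text \<open>Cauchy's inequality on the circle of radius r loses a factor r^n, which disappears as r
  tends to 1.\<close>

lemma scalar_coeff_bound: "cmod (scalar_coeff n x y) \<le> K * norm x * norm y"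
proof -
  let ?f = "\<lambda>z. cinner (F z x) y" and ?B = "K * norm x * norm y"
  have f: "cmod (?f z) \<le> ?B" if "z \<in> ball 0 1" for z
    using order_trans[OF cmod_cinner_le mult_right_mono[OF F_bound[OF that, of x] norm_ge_zero[of y]]]
    by blast
  have *: "cmod (scalar_coeff n x y) * r ^ n \<le> ?B" if r: "r \<in> {0<..<1}" for r :: real
  proof -
    have sub: "cball 0 r \<subseteq> ball (0::complex) 1" "ball 0 r \<subseteq> ball (0::complex) 1" using r by auto
    have "cmod ((deriv ^^ n) ?f 0) \<le> fact n * ?B / r ^ n"
    proof (rule Cauchy_inequality)
      show "?f holomorphic_on ball 0 r" by (rule holomorphic_on_subset[OF F_holo sub(2)])
      show "continuous_on (cball 0 r) ?f"
        by (intro holomorphic_on_imp_continuous_on holomorphic_on_subset[OF F_holo sub(1)])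
      show "cmod (?f w) \<le> ?B" if "cmod (0 - w) = r" for w
        using that r by (intro f) simp
    qed (use r in simp)
    then show ?thesis
      using r by (simp add: scalar_coeff_def norm_divide field_simps)
  qed
  show ?thesis
  proof (rule tendsto_upperbound)
    show "((\<lambda>r. cmod (scalar_coeff n x y) * r ^ n) \<longlongrightarrow> cmod (scalar_coeff n x y)) (at_left (1::real))"
      by (auto intro!: tendsto_eq_intros)
    show "\<forall>\<^sub>F r in at_left 1. cmod (scalar_coeff n x y) * r ^ n \<le> ?B"
      using eventually_at_left_real[OF zero_less_one] by (rule eventually_mono) (use * in auto)
  qed simp
qed

text \<open>Riesz representation in the second argument; conjugation makes the functional linear
  there.\<close>

lemma coeff_exists: "\<exists>v. \<forall>y. scalar_coeff n x y = cinner v y"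
proof -
  have add: "scalar_coeff n x (y + y') = scalar_coeff n x y + scalar_coeff n x y'" for y y'
    using higher_deriv_add[OF F_holo[of x y] F_holo[of x y'], of 0 n]
    by (simp add: scalar_coeff_def cinner_add_right add_divide_distrib)
  have scale: "scalar_coeff n x (c *\<^sub>C y) = cnj c * scalar_coeff n x y" for c y
    using higher_deriv_cmult[OF F_holo[of x y], of 0 n "cnj c"]
    by (simp add: scalar_coeff_def cinner_scaleC_right)
  obtain v where "\<And>y. cnj (scalar_coeff n x y) = cinner y v"
    by (rule riesz_representation[of "\<lambda>y. cnj (scalar_coeff n x y)" "K * norm x"])
      (simp_all add: add scale scalar_coeff_bound)
  then have "scalar_coeff n x y = cinner v y" for y
    by (metis cinner_commute complex_cnj_cnj)
  then show ?thesis by blast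
qed

definition coeff :: "nat \<Rightarrow> 'a \<Rightarrow> 'b" where
  "coeff n x = (SOME v. \<forall>y. scalar_coeff n x y = cinner v y)"

lemma cinner_coeff: "cinner (coeff n x) y = scalar_coeff n x y"
  using someI_ex[OF coeff_exists[of n x]] unfolding coeff_def[symmetric] by simp

lemma norm_coeff: "norm (coeff n x) \<le> K * norm x"
  using K by (intro norm_le_by_cinner) (auto simp: cinner_coeff scalar_coeff_bound)

lemma coeff_zero [simp]: "coeff n 0 = 0"
  using norm_coeff[of n 0] by simp

text \<open>The coefficient bound gives convergence in norm; the limit is then identified weakly,
  through the scalar power series.\<close>

lemma coeff_sums:
  assumes "z \<in> ball 0 1"
  shows "(\<lambda>n. z ^ n *\<^sub>C coeff n x) sums F z x"
proof -
  have "summable (\<lambda>n. z ^ n *\<^sub>C coeff n x)"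
  proof (rule summable_comparison_test')
    show "summable (\<lambda>n. cmod z ^ n * (K * norm x))"
      using assms by (intro summable_mult2 summable_geometric) simp
    show "norm (z ^ n *\<^sub>C coeff n x) \<le> cmod z ^ n * (K * norm x)" for n
      by (simp add: norm_scaleC norm_power mult_left_mono norm_coeff)
  qed
  then obtain s where s: "(\<lambda>n. z ^ n *\<^sub>C coeff n x) sums s" by (auto simp: summable_def)
  have "s = F z x"
  proof (rule cinner_eqI)
    fix y
    have "(\<lambda>n. cinner (z ^ n *\<^sub>C coeff n x) y) sums cinner s y"
      by (rule bounded_linear.sums[OF bounded_linear_cinner_left s])
    then have "(\<lambda>n. scalar_coeff n x y * z ^ n) sums cinner s y"
      by (simp add: cinner_scaleC_left cinner_coeff mult.commute)
    moreover have "(\<lambda>n. scalar_coeff n x y * z ^ n) sums cinner (F z x) y"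
      using holomorphic_power_series[OF F_holo assms, of x y] by (simp add: scalar_coeff_def)
    ultimately show "cinner s y = cinner (F z x) y" by (rule sums_unique2)
  qed
  with s show ?thesis by simp
qed

section \<open>Cauchy products with the coefficients of the symbol\<close>

definition conv :: "(nat \<Rightarrow> 'a) \<Rightarrow> nat \<Rightarrow> 'b" where
  "conv g n = (\<Sum>j\<le>n. coeff (n - j) (g j))"

definition trunc :: "nat \<Rightarrow> (nat \<Rightarrow> 'a) \<Rightarrow> nat \<Rightarrow> 'a" where
  "trunc M g j = (if j < M then g j else 0)"

lemma conv_trunc_eq: "n < M \<Longrightarrow> conv (trunc M g) n = conv g n"
  unfolding conv_def by (intro sum.cong refl) (simp add: trunc_def)

lemma conv_trunc:
  "conv (trunc M g) n = (\<Sum>j<M. if j \<le> n then coeff (n - j) (g j) else 0)"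
proof -
  have "conv (trunc M g) n = (\<Sum>j\<in>{..<M} \<inter> {..n}. coeff (n - j) (g j))"
    unfolding conv_def
    by (rule sum.mono_neutral_cong_right) (auto simp: trunc_def)
  also have "\<dots> = (\<Sum>j<M. if j \<in> {..n} then coeff (n - j) (g j) else 0)"
    by (rule sum.inter_restrict) simp
  finally show ?thesis by simp
qed

text \<open>For a polynomial input only finitely many series are added, the one for
  \<open>g j\<close> shifted by \<open>j\<close>; no interchange of infinite sums arises.\<close>

lemma conv_trunc_sums:
  assumes z: "z \<in> ball 0 1"
  shows "(\<lambda>n. z ^ n *\<^sub>C conv (trunc M g) n) sums F z (\<Sum>j<M. z ^ j *\<^sub>C g j)"
proof -
  have 1: "(\<lambda>n. z ^ n *\<^sub>C (if j \<le> n then coeff (n - j) (g j) else 0)) sums F z (z ^ j *\<^sub>C g j)" for j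
  proof -
    have "(\<lambda>n. z ^ j *\<^sub>C z ^ n *\<^sub>C coeff n (g j)) sums (z ^ j *\<^sub>C F z (g j))"
      by (rule bounded_linear.sums[OF bounded_linear_scaleC coeff_sums[OF z]])
    then have "(\<lambda>n. z ^ (n + j) *\<^sub>C (if j \<le> n + j then coeff (n + j - j) (g j) else 0))
        sums F z (z ^ j *\<^sub>C g j)"
      by (simp add: scaleC_scaleC power_add mult.commute Bop_scaleC[OF F_Bop[OF z]])
    then show ?thesis
      by (subst (asm) sums_zero_iff_shift) auto
  qed
  have "(\<lambda>n. \<Sum>j<M. z ^ n *\<^sub>C (if j \<le> n then coeff (n - j) (g j) else 0))
      sums (\<Sum>j<M. F z (z ^ j *\<^sub>C g j))"
    by (rule sums_sum) (rule 1)
  moreover have "(\<Sum>j<M. F z (z ^ j *\<^sub>C g j)) = F z (\<Sum>j<M. z ^ j *\<^sub>C g j)"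
    using linear_sum[OF bounded_linear.linear[OF Bop_bounded_linear[OF F_Bop[OF z]]]] by metis
  ultimately show ?thesis
    by (simp add: conv_trunc scaleC_sum_right)
qed

lemma norm_conv_trunc_le: "norm (conv (trunc M g) n) \<le> (\<Sum>j<M. K * norm (g j))"
  unfolding conv_trunc
  by (rule sum_norm_le) (auto simp: norm_coeff K)

text \<open>The discrete transform on \<open>N\<close> points collects all coefficients whose index
  is congruent to \<open>j\<close> modulo \<open>N\<close>. Apart from \<open>j\<close> itself these
  indices are at least \<open>N\<close>, so their total is O(r^N).\<close>

lemma fourier_coefficient_tendsto:
  fixes g :: "nat \<Rightarrow> 'a" and M :: nat and r :: real
  assumes r: "0 < r" "r < 1"
  defines "u \<equiv> \<lambda>N k. F (of_real r * unit_root N ^ k)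
      (\<Sum>i<M. (of_real r * unit_root N ^ k) ^ i *\<^sub>C g i)"
  shows "(\<lambda>N. (1 / of_nat N) *\<^sub>C (\<Sum>k<N. cnj (unit_root N ^ (k * j)) *\<^sub>C u N k))
    \<longlonglongrightarrow> r ^ j *\<^sub>R conv (trunc M g) j"
proof -
  let ?h = "conv (trunc M g)"
  define H where "H N = (1 / of_nat N) *\<^sub>C (\<Sum>k<N. cnj (unit_root N ^ (k * j)) *\<^sub>C u N k)" for N
  define B where "B = (\<Sum>i<M. K * norm (g i))"
  have "norm (H N - r ^ j *\<^sub>R ?h j) \<le> B / (1 - r) * r ^ N" if N: "j < N" for N
  proof -
    have uk: "(\<lambda>n. (of_real r * unit_root N ^ k) ^ n *\<^sub>C ?h n) sums u N k" for k
      unfolding u_def using r by (intro conv_trunc_sums) (simp add: norm_mult norm_power)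
    have "(\<lambda>n. (1 / of_nat N) *\<^sub>C (\<Sum>k<N. cnj (unit_root N ^ (k * j)) *\<^sub>C
        (of_real r * unit_root N ^ k) ^ n *\<^sub>C ?h n)) sums H N"
      unfolding H_def
      by (intro bounded_linear.sums[OF bounded_linear_scaleC] sums_sum uk)
    moreover have "(1 / of_nat N) *\<^sub>C (\<Sum>k<N. cnj (unit_root N ^ (k * j)) *\<^sub>C
        (of_real r * unit_root N ^ k) ^ n *\<^sub>C ?h n)
        = (if N dvd n + N - j then r ^ n *\<^sub>R ?h n else 0)" for n
    proof -
      have "(1 / of_nat N) * (\<Sum>k<N. cnj (unit_root N ^ (k * j)) * (of_real r * unit_root N ^ k) ^ n)
          = (1 / of_nat N) * of_real (r ^ n) * (\<Sum>k<N. cnj (unit_root N ^ (k * j)) * unit_root N ^ (k * n))"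
        by (simp add: power_mult_distrib power_mult sum_distrib_left mult_ac)
      also have "\<dots> = complex_of_real (if N dvd n + N - j then r ^ n else 0)"
        unfolding sum_unit_root_orthogonal[OF N] using N by simp
      finally have "(1 / of_nat N) *\<^sub>C (\<Sum>k<N. cnj (unit_root N ^ (k * j)) *\<^sub>C
          (of_real r * unit_root N ^ k) ^ n *\<^sub>C ?h n)
          = complex_of_real (if N dvd n + N - j then r ^ n else 0) *\<^sub>C ?h n"
        by (simp add: scaleC_scaleC flip: scaleC_sum_left)
      then show ?thesis unfolding scaleC_of_real by simp
    qed
    ultimately have "(\<lambda>n. if N dvd n + N - j then r ^ n *\<^sub>R ?h n else 0) sums H N" by simp
    moreover have "(\<lambda>n. if n = j then r ^ n *\<^sub>R ?h n else 0) sums (r ^ j *\<^sub>R ?h j)"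
      by (rule sums_single)
    ultimately have "(\<lambda>n. (if N dvd n + N - j then r ^ n *\<^sub>R ?h n else 0)
        - (if n = j then r ^ n *\<^sub>R ?h n else 0)) sums (H N - r ^ j *\<^sub>R ?h j)"
      by (rule sums_diff)
    then show ?thesis
    proof (rule sums_tail_norm_le)
      fix n
      show "(if N dvd n + N - j then r ^ n *\<^sub>R ?h n else 0) - (if n = j then r ^ n *\<^sub>R ?h n else 0) = 0"
        if "n < N"
        using dvd_add_diff_iff[OF that N] by simp
      have "norm (r ^ n *\<^sub>R ?h n) \<le> B * r ^ n"
        using norm_conv_trunc_le[of M g n] r by (simp add: B_def mult.commute)
      moreover have "0 \<le> B * r ^ n"
        using r K by (simp add: B_def sum_nonneg)
      ultimately show "norm ((if N dvd n + N - j then r ^ n *\<^sub>R ?h n else 0)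
          - (if n = j then r ^ n *\<^sub>R ?h n else 0)) \<le> B * r ^ n"
        by auto
    qed (use r in auto)
  qed
  then have ev: "\<forall>\<^sub>F N in sequentially. norm (H N - r ^ j *\<^sub>R ?h j) \<le> B / (1 - r) * r ^ N"
    using eventually_gt_at_top[of j] by (rule eventually_mono[rotated])
  have "(\<lambda>N. B / (1 - r) * r ^ N) \<longlonglongrightarrow> B / (1 - r) * 0"
    using r by (intro tendsto_intros LIMSEQ_realpow_zero) auto
  then have "(\<lambda>N. H N - r ^ j *\<^sub>R ?h j) \<longlonglongrightarrow> 0"
    by (intro Lim_null_comparison[OF ev]) simp
  then show ?thesis
    unfolding H_def by (simp add: LIM_zero_iff)
qed

text \<open>The lower triangular block Toeplitz matrix of the Taylor coefficients is bounded by \<open>K\<close>. Parseval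
  on the \<open>N\<close>-th roots of unity, scaled by \<open>r < 1\<close>, bounds the aliased coefficients of \<open>F g\<close>;
  then \<open>N \<rightarrow> \<infinity>\<close> and \<open>r \<rightarrow> 1\<close>.\<close>

lemma conv_l2_bound: "(\<Sum>n<M. (norm (conv g n))\<^sup>2) \<le> K\<^sup>2 * (\<Sum>j<M. (norm (g j))\<^sup>2)"
proof -
  let ?h = "conv (trunc M g)" and ?R = "K\<^sup>2 * (\<Sum>j<M. (norm (g j))\<^sup>2)"
  have main: "(\<Sum>n<M. (norm (r ^ n *\<^sub>R ?h n))\<^sup>2) \<le> ?R" if r: "0 < r" "r < 1" for r :: real
  proof -
    define w where "w N k = of_real r * unit_root N ^ k" for N k
    define u where "u N k = F (w N k) (\<Sum>i<M. w N k ^ i *\<^sub>C g i)" for N k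
    define H where "H N j = (1 / of_nat N) *\<^sub>C (\<Sum>k<N. cnj (unit_root N ^ (k * j)) *\<^sub>C u N k)" for N j
    have w: "w N k \<in> ball 0 1" for N k
      using r by (simp add: w_def norm_mult norm_power)
    have H: "(\<lambda>N. H N j) \<longlonglongrightarrow> r ^ j *\<^sub>R ?h j" for j
      unfolding H_def u_def w_def by (rule fourier_coefficient_tendsto[OF r])
    have bound: "(\<Sum>j<M. (norm (H N j))\<^sup>2) \<le> ?R" if N: "N > 0" "N \<ge> M" for N
    proof -
      \<comment> \<open>Padding with zeros to \<open>N\<close> terms turns the sample values into a
        discrete transform, ready for Parseval.\<close>
      have poly: "(\<Sum>i<M. w N k ^ i *\<^sub>C g i) = (\<Sum>i<N. unit_root N ^ (k * i) *\<^sub>C r ^ i *\<^sub>R trunc M g i)" for k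
      proof -
        have "(\<Sum>i<N. unit_root N ^ (k * i) *\<^sub>C r ^ i *\<^sub>R trunc M g i)
            = (\<Sum>i<M. unit_root N ^ (k * i) *\<^sub>C r ^ i *\<^sub>R trunc M g i)"
          using N by (intro sum.mono_neutral_right) (auto simp: trunc_def)
        also have "\<dots> = (\<Sum>i<M. w N k ^ i *\<^sub>C g i)"
          by (intro sum.cong refl) (simp add: trunc_def w_def scaleC_scaleC power_mult_distrib
              mult.commute flip: scaleC_of_real power_mult)
        finally show ?thesis by simp
      qed
      have "(\<Sum>j<M. (norm (H N j))\<^sup>2) \<le> (\<Sum>j<N. (norm (H N j))\<^sup>2)"
        using N by (intro sum_mono2) auto
      also have "\<dots> = (\<Sum>j<N. (norm (\<Sum>k<N. cnj (unit_root N ^ (k * j)) *\<^sub>C u N k))\<^sup>2) / (real N)\<^sup>2"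
        by (simp add: H_def norm_scaleC norm_divide power_divide sum_divide_distrib)
      also have "\<dots> = (\<Sum>k<N. (norm (u N k))\<^sup>2) / real N"
        unfolding parseval_unit_root_cnj using N by (simp add: power2_eq_square)
      also have "\<dots> \<le> (\<Sum>k<N. K\<^sup>2 * (norm (\<Sum>i<M. w N k ^ i *\<^sub>C g i))\<^sup>2) / real N"
        unfolding u_def power_mult_distrib[symmetric]
        by (intro divide_right_mono sum_mono power_mono F_bound w) auto
      also have "\<dots> = K\<^sup>2 * (\<Sum>k<N. (norm (\<Sum>i<M. w N k ^ i *\<^sub>C g i))\<^sup>2) / real N"
        by (simp add: sum_distrib_left)
      also have "\<dots> = K\<^sup>2 * (\<Sum>k<N. (norm (\<Sum>i<N. unit_root N ^ (k * i) *\<^sub>C r ^ i *\<^sub>R trunc M g i))\<^sup>2) / real N"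
        by (simp only: poly)
      also have "K\<^sup>2 * (\<Sum>k<N. (norm (\<Sum>i<N. unit_root N ^ (k * i) *\<^sub>C r ^ i *\<^sub>R trunc M g i))\<^sup>2) / real N
          = K\<^sup>2 * (\<Sum>i<N. (norm (r ^ i *\<^sub>R trunc M g i))\<^sup>2)"
        unfolding parseval_unit_root using N by simp
      also have "(\<Sum>i<N. (norm (r ^ i *\<^sub>R trunc M g i))\<^sup>2) = (\<Sum>i<M. (norm (r ^ i *\<^sub>R trunc M g i))\<^sup>2)"
        using N by (intro sum.mono_neutral_right) (auto simp: trunc_def)
      also have "K\<^sup>2 * \<dots> \<le> ?R"
        using r by (intro mult_left_mono sum_mono power_mono)
          (auto simp: trunc_def mult_left_le_one_le power_le_one)
      finally show ?thesis .
    qed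
    show ?thesis
    proof (rule tendsto_upperbound)
      show "(\<lambda>N. \<Sum>j<M. (norm (H N j))\<^sup>2) \<longlonglongrightarrow> (\<Sum>n<M. (norm (r ^ n *\<^sub>R ?h n))\<^sup>2)"
        by (intro tendsto_intros H)
      show "\<forall>\<^sub>F N in sequentially. (\<Sum>j<M. (norm (H N j))\<^sup>2) \<le> ?R"
        \<comment> \<open>\<open>Suc M\<close> ensures \<open>N > 0\<close> also when
          \<open>M = 0\<close>.\<close>
        using eventually_ge_at_top[of "Suc M"] by (rule eventually_mono) (simp add: bound)
    qed simp
  qed
  have "(\<Sum>n<M. (norm (?h n))\<^sup>2) \<le> ?R"
  proof (rule tendsto_upperbound)
    show "((\<lambda>r. \<Sum>n<M. (norm (r ^ n *\<^sub>R ?h n))\<^sup>2) \<longlongrightarrow> (\<Sum>n<M. (norm (?h n))\<^sup>2)) (at_left (1::real))"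
      by (auto intro!: tendsto_eq_intros)
    show "\<forall>\<^sub>F r in at_left (1::real). (\<Sum>n<M. (norm (r ^ n *\<^sub>R ?h n))\<^sup>2) \<le> ?R"
      using eventually_at_left_real[OF zero_less_one] by (rule eventually_mono) (use main in auto)
  qed simp
  then show ?thesis by (simp add: conv_trunc_eq)
qed

lemma conv_sqsummable:
  assumes "sqsummable g"
  shows "sqsummable (conv g)"
    and "(\<Sum>n. (norm (conv g n))\<^sup>2) \<le> K\<^sup>2 * (\<Sum>n. (norm (g n))\<^sup>2)"
proof -
  have b: "(\<Sum>n<M. (norm (conv g n))\<^sup>2) \<le> K\<^sup>2 * (\<Sum>n. (norm (g n))\<^sup>2)" for M
    using conv_l2_bound[of g M] assms unfolding sqsummable_def
    by (meson K mult_left_mono order_trans sum_le_suminf finite_lessThan zero_le_power2)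
  then show s: "sqsummable (conv g)"
    unfolding sqsummable_def by (intro summableI_nonneg_bounded) auto
  show "(\<Sum>n. (norm (conv g n))\<^sup>2) \<le> K\<^sup>2 * (\<Sum>n. (norm (g n))\<^sup>2)"
    using s b unfolding sqsummable_def by (intro suminf_le_const) auto
qed

lemma norm_conv_le:
  assumes "sqsummable g"
  shows "norm (conv g n) \<le> K * sqrt (\<Sum>n. (norm (g n))\<^sup>2)"
proof -
  have "(norm (conv g n))\<^sup>2 \<le> (\<Sum>n. (norm (conv g n))\<^sup>2)"
    using conv_sqsummable(1)[OF assms] sum_le_suminf[of "\<lambda>n. (norm (conv g n))\<^sup>2" "{n}"]
    unfolding sqsummable_def by simp
  also have "\<dots> \<le> K\<^sup>2 * (\<Sum>n. (norm (g n))\<^sup>2)" by (rule conv_sqsummable(2)[OF assms])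
  finally have "norm (conv g n) \<le> sqrt (K\<^sup>2 * (\<Sum>n. (norm (g n))\<^sup>2))" by (rule real_le_rsqrt)
  then show ?thesis using K by (simp add: real_sqrt_mult)
qed

text \<open>Both sides are compared with the truncation of \<open>g\<close> at \<open>M\<close>: the
  left by the tail estimate, whose constant does not depend on \<open>M\<close>, and the right by
  continuity of \<open>F z\<close>.\<close>

lemma taylor_fun_conv:
  assumes g: "sqsummable g" and z: "z \<in> ball 0 1"
  shows "taylor_fun (conv g) z = F z (taylor_fun g z)"
proof -
  define S where "S M = (\<Sum>j<M. z ^ j *\<^sub>C g j)" for M
  let ?B = "K * sqrt (\<Sum>n. (norm (g n))\<^sup>2)"
  have "(\<lambda>n. z ^ n *\<^sub>C g n) sums taylor_fun g z"
    using summable_taylor[OF g] z by (simp add: taylor_fun_def summable_sums)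
  then have "S \<longlonglongrightarrow> taylor_fun g z"
    unfolding S_def sums_def .
  then have 1: "(\<lambda>M. F z (S M)) \<longlonglongrightarrow> F z (taylor_fun g z)"
    by (rule bounded_linear.tendsto[OF Bop_bounded_linear[OF F_Bop[OF z]]])
  have c: "(\<lambda>n. z ^ n *\<^sub>C conv g n) sums taylor_fun (conv g) z"
    using summable_taylor[OF conv_sqsummable(1)[OF g]] z by (simp add: taylor_fun_def summable_sums)
  have tr: "sqsummable (trunc M g)" and tr_le: "(\<Sum>n. (norm (trunc M g n))\<^sup>2) \<le> (\<Sum>n. (norm (g n))\<^sup>2)" for M
  proof -
    show s: "sqsummable (trunc M g)"
      using g unfolding sqsummable_def
      by (rule summable_comparison_test') (simp add: trunc_def)
    show "(\<Sum>n. (norm (trunc M g n))\<^sup>2) \<le> (\<Sum>n. (norm (g n))\<^sup>2)"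
      using g s unfolding sqsummable_def by (intro suminf_le) (auto simp: trunc_def)
  qed
  have est: "norm (F z (S M) - taylor_fun (conv g) z) \<le> (2 * ?B) / (1 - cmod z) * cmod z ^ M" for M
  proof (rule sums_tail_norm_le)
    show "(\<lambda>n. z ^ n *\<^sub>C conv (trunc M g) n - z ^ n *\<^sub>C conv g n) sums (F z (S M) - taylor_fun (conv g) z)"
      unfolding S_def by (intro sums_diff conv_trunc_sums[OF z] c)
    show "z ^ n *\<^sub>C conv (trunc M g) n - z ^ n *\<^sub>C conv g n = 0" if "n < M" for n
      by (simp add: conv_trunc_eq[OF that])
    show "norm (z ^ n *\<^sub>C conv (trunc M g) n - z ^ n *\<^sub>C conv g n) \<le> (2 * ?B) * cmod z ^ n" for n
    proof -
      have "norm (conv (trunc M g) n) \<le> ?B"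
        by (rule order_trans[OF norm_conv_le[OF tr]])
          (intro mult_left_mono real_sqrt_le_mono tr_le K)
      then have "norm (conv (trunc M g) n - conv g n) \<le> 2 * ?B"
        using norm_conv_le[OF g, of n] norm_triangle_ineq4[of "conv (trunc M g) n" "conv g n"] by linarith
      then have "cmod z ^ n * norm (conv (trunc M g) n - conv g n) \<le> cmod z ^ n * (2 * ?B)"
        by (intro mult_left_mono) auto
      then show ?thesis
        by (simp add: norm_scaleC norm_power mult.commute flip: scaleC_diff_right)
    qed
  qed (use z in auto)
  have "(\<lambda>M. (2 * ?B) / (1 - cmod z) * cmod z ^ M) \<longlonglongrightarrow> (2 * ?B) / (1 - cmod z) * 0"
    using z by (intro tendsto_intros LIMSEQ_realpow_zero) auto
  then have "(\<lambda>M. F z (S M) - taylor_fun (conv g) z) \<longlonglongrightarrow> 0"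
    unfolding mult_zero_right
    by (rule Lim_null_comparison[OF always_eventually[OF allI[OF est]]])
  then have "(\<lambda>M. F z (S M)) \<longlonglongrightarrow> taylor_fun (conv g) z"
    by (simp add: LIM_zero_iff)
  then show ?thesis using LIMSEQ_unique 1 by blast
qed

text \<open>With \<open>conv_sqsummable\<close> this places the pointwise product in the type
  \<open>hardy2\<close>, as \<open>Abs_hardy2\<close> in \<open>toeplitz\<close> requires.\<close>

lemma toeplitz_eq: "toeplitz F g = Abs_hardy2 (taylor_fun (conv (hardy_coeff g)))"
proof -
  have "(\<lambda>z\<in>ball 0 1. F z (hardy_fun g z)) = taylor_fun (conv (hardy_coeff g))"
  proof
    fix z
    show "(\<lambda>z\<in>ball 0 1. F z (hardy_fun g z)) z = taylor_fun (conv (hardy_coeff g)) z"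
    proof (cases "z \<in> ball 0 1")
      case True
      then show ?thesis
        using taylor_fun_conv[OF sqsummable_hardy_coeff True] by (simp add: hardy_fun_eq)
    qed (simp add: taylor_fun_def)
  qed
  then show ?thesis by (simp add: toeplitz_def)
qed

lemma hardy_coeff_toeplitz: "hardy_coeff (toeplitz F g) = conv (hardy_coeff g)"
  unfolding toeplitz_eq by (intro hardy_coeff_Abs conv_sqsummable sqsummable_hardy_coeff)

lemma hardy_fun_toeplitz: "z \<in> ball 0 1 \<Longrightarrow> hardy_fun (toeplitz F g) z = F z (hardy_fun g z)"
  unfolding hardy_fun_eq hardy_coeff_toeplitz by (rule taylor_fun_conv[OF sqsummable_hardy_coeff])

lemma norm_toeplitz_le: "norm (toeplitz F g) \<le> K * norm g"
proof -
  have "norm (toeplitz F g) \<le> sqrt (K\<^sup>2 * (\<Sum>n. (norm (hardy_coeff g n))\<^sup>2))"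
    unfolding norm_hardy2_def hardy_coeff_toeplitz
    by (intro real_sqrt_le_mono conv_sqsummable sqsummable_hardy_coeff)
  then show ?thesis using K by (simp add: real_sqrt_mult norm_hardy2_def)
qed

end

lemma hardy2_eqI:
  assumes "\<And>z. z \<in> ball 0 1 \<Longrightarrow> hardy_fun f z = hardy_fun g z"
  shows "f = g"
proof -
  have "hardy_fun f z = hardy_fun g z" for z
    using assms[of z] by (cases "z \<in> ball 0 1") (simp_all add: hardy_fun_eq taylor_fun_def)
  then show ?thesis by (metis ext hardy_fun_inject)
qed

lemma hardy_fun_add: "z \<in> ball 0 1 \<Longrightarrow> hardy_fun (f + g) z = hardy_fun f z + hardy_fun g z"
  by (simp add: plus_hardy2.rep_eq)

lemma hardy_fun_scaleC: "z \<in> ball 0 1 \<Longrightarrow> hardy_fun (c *\<^sub>C f) z = c *\<^sub>C hardy_fun f z"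
  by (simp add: scaleC_hardy2.rep_eq)

lemma hardy_fun_diff: "z \<in> ball 0 1 \<Longrightarrow> hardy_fun (f - g) z = hardy_fun f z - hardy_fun g z"
  using hardy_fun_add[of z "f - g" g] by (simp add: algebra_simps)

lemma (in bounded_analytic) toeplitz_Bop: "toeplitz F \<in> Bop"
proof -
  have "toeplitz F (f + g) = toeplitz F f + toeplitz F g" for f g
    by (rule hardy2_eqI) (simp add: hardy_fun_toeplitz hardy_fun_add Bop_add[OF F_Bop] del: mem_ball)
  moreover have "toeplitz F (c *\<^sub>C f) = c *\<^sub>C toeplitz F f" for c f
    by (rule hardy2_eqI) (simp add: hardy_fun_toeplitz hardy_fun_scaleC Bop_scaleC[OF F_Bop] del: mem_ball)
  ultimately show ?thesis
    using norm_toeplitz_le by (auto simp: bounded_ops_def intro!: exI[of _ K])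
qed

subsection \<open>Reproducing kernels\<close>

text \<open>The Szego kernel at \<open>w\<close> in direction \<open>x\<close>, encoded by its
  coefficients because these define the inner product.\<close>

definition kernel :: "complex \<Rightarrow> 'a::chilbert_space \<Rightarrow> 'a hardy2" where
  "kernel w x = Abs_hardy2 (taylor_fun (\<lambda>n. cnj w ^ n *\<^sub>C x))"

lemma kernel_norm_sums:
  assumes "w \<in> ball 0 1"
  shows "(\<lambda>n. (norm (cnj w ^ n *\<^sub>C x))\<^sup>2) sums ((norm x)\<^sup>2 / (1 - (cmod w)\<^sup>2))"
proof -
  have "(cmod w)\<^sup>2 < 1" using assms by (simp add: power_less_one_iff abs_square_less_1)
  then have "(\<lambda>n. (norm x)\<^sup>2 * ((cmod w)\<^sup>2) ^ n) sums ((norm x)\<^sup>2 * (1 / (1 - (cmod w)\<^sup>2)))"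
    by (intro sums_mult geometric_sums) simp
  then show ?thesis
    by (simp add: norm_scaleC norm_power power_mult_distrib mult.commute flip: power_mult)
qed

lemma hardy_coeff_kernel: "w \<in> ball 0 1 \<Longrightarrow> hardy_coeff (kernel w x) = (\<lambda>n. cnj w ^ n *\<^sub>C x)"
  unfolding kernel_def
  by (intro hardy_coeff_Abs) (simp add: sqsummable_def sums_summable[OF kernel_norm_sums])

lemma norm_kernel: "w \<in> ball 0 1 \<Longrightarrow> norm (kernel w x) = norm x / sqrt (1 - (cmod w)\<^sup>2)"
  by (simp add: norm_hardy2_def hardy_coeff_kernel real_sqrt_divide
      sums_unique[OF kernel_norm_sums, symmetric])

lemma hardy_fun_sums:
  "z \<in> ball 0 1 \<Longrightarrow> (\<lambda>n. z ^ n *\<^sub>C hardy_coeff g n) sums hardy_fun g z"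
  using summable_taylor[OF sqsummable_hardy_coeff[of g]]
  by (simp add: hardy_fun_eq taylor_fun_def summable_sums)

lemma hardy_fun_kernel:
  assumes "w \<in> ball 0 1" "z \<in> ball 0 1"
  shows "hardy_fun (kernel w x) z = (1 / (1 - z * cnj w)) *\<^sub>C x"
proof (rule sums_unique2[OF hardy_fun_sums[OF assms(2)]])
  have "cmod z * cmod w < 1 * 1"
    using assms by (intro mult_strict_mono') auto
  then have "(\<lambda>n. (z * cnj w) ^ n) sums (1 / (1 - z * cnj w))"
    by (intro geometric_sums) (simp add: norm_mult)
  moreover have "bounded_linear (\<lambda>c. c *\<^sub>C x)"
    by (rule bounded_linear_intro[where K = "norm x"])
      (simp_all add: scaleC_add_left scaleR_conv_of_real norm_scaleC scaleC_scaleC flip: scaleC_of_real)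
  ultimately have "(\<lambda>n. (z * cnj w) ^ n *\<^sub>C x) sums ((1 / (1 - z * cnj w)) *\<^sub>C x)"
    using bounded_linear.sums by blast
  then show "(\<lambda>n. z ^ n *\<^sub>C hardy_coeff (kernel w x) n) sums ((1 / (1 - z * cnj w)) *\<^sub>C x)"
    by (simp add: hardy_coeff_kernel[OF assms(1)] scaleC_scaleC power_mult_distrib)
qed

lemma hardy_fun_kernel_0: "z \<in> ball 0 1 \<Longrightarrow> hardy_fun (kernel 0 x) z = x"
  using hardy_fun_kernel[of 0 z x] by simp

lemma kernel_reproducing:
  assumes "w \<in> ball 0 1"
  shows "cinner (hardy_fun g w) y = cinner g (kernel w y)"
proof (rule sums_unique2)
  show "(\<lambda>n. cinner (w ^ n *\<^sub>C hardy_coeff g n) y) sums cinner (hardy_fun g w) y"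
    by (rule bounded_linear.sums[OF bounded_linear_cinner_left hardy_fun_sums[OF assms]])
  have "(\<lambda>n. cinner (hardy_coeff g n) (hardy_coeff (kernel w y) n)) sums cinner g (kernel w y)"
    unfolding cinner_hardy2_def by (rule summable_sums[OF summable_cinner_hardy])
  then show "(\<lambda>n. cinner (w ^ n *\<^sub>C hardy_coeff g n) y) sums cinner g (kernel w y)"
    by (simp add: hardy_coeff_kernel[OF assms] cinner_scaleC_left cinner_scaleC_right)
qed

lemma norm_hardy_fun_le:
  assumes "w \<in> ball 0 1"
  shows "norm (hardy_fun g w) \<le> norm g / sqrt (1 - (cmod w)\<^sup>2)"
proof (rule norm_le_by_cinner)
  have w: "(cmod w)\<^sup>2 < 1" using assms by (simp add: power_less_one_iff abs_square_less_1)
  show "0 \<le> norm g / sqrt (1 - (cmod w)\<^sup>2)" using w by simp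
  show "cmod (cinner (hardy_fun g w) y) \<le> norm g / sqrt (1 - (cmod w)\<^sup>2) * norm y" for y
    using cmod_cinner_le[of g "kernel w y"]
    by (simp add: kernel_reproducing[OF assms] norm_kernel[OF assms])
qed

text \<open>With s = 1 - |w|^2, the image of the kernel takes the value F(w)x / s at w. Evaluation
  and the norm of the kernel each cost a factor 1 / sqrt s, so s cancels and \<open>c\<close> is
  preserved.\<close>

lemma (in bounded_analytic) pointwise_norm_le:
  assumes w: "w \<in> ball 0 1" and c: "norm (toeplitz F (kernel w x)) \<le> c * norm (kernel w x)"
  shows "norm (F w x) \<le> c * norm x"
proof -
  define s where "s = 1 - (cmod w)\<^sup>2"
  have s: "s > 0" using w by (simp add: s_def power_less_one_iff abs_square_less_1)
  have "1 - w * cnj w = complex_of_real s"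
    by (simp add: s_def complex_norm_square[symmetric] flip: of_real_power)
  then have "hardy_fun (toeplitz F (kernel w x)) w = complex_of_real (1 / s) *\<^sub>C F w x"
    by (simp add: hardy_fun_toeplitz[OF w] hardy_fun_kernel[OF w w] Bop_scaleC[OF F_Bop[OF w]])
  then have "norm (F w x) / s = norm (hardy_fun (toeplitz F (kernel w x)) w)"
    using s by (simp add: norm_scaleC norm_divide del: of_real_divide)
  also have "\<dots> \<le> norm (toeplitz F (kernel w x)) / sqrt s"
    unfolding s_def by (rule norm_hardy_fun_le[OF w])
  also have "\<dots> \<le> c * norm (kernel w x) / sqrt s"
    using s by (intro divide_right_mono c) simp
  also have "\<dots> = c * norm x / s"
    using s by (simp add: norm_kernel[OF w] s_def[symmetric])
  finally show ?thesis using s by (simp add: divide_le_cancel)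
qed


subsection \<open>Constant functions\<close>

lemma bounded_analytic_const:
  assumes "T \<in> Bop" "\<And>x. norm (T x) \<le> K * norm x" "0 \<le> K"
  shows "bounded_analytic (\<lambda>z\<in>ball 0 1. T) K"
proof
  fix x y
  have "(\<lambda>z. cinner ((\<lambda>z\<in>ball 0 1. T) z x) y) holomorphic_on ball 0 1
      \<longleftrightarrow> (\<lambda>z. cinner (T x) y) holomorphic_on ball 0 1"
    by (rule holomorphic_cong) auto
  then show "(\<lambda>z. cinner ((\<lambda>z\<in>ball 0 1. T) z x) y) holomorphic_on ball 0 1" by simp
qed (use assms in auto)

lemma hardy_coeff_toeplitz_const:
  assumes T: "T \<in> Bop"
  shows "hardy_coeff (toeplitz (\<lambda>z\<in>ball 0 1. T) g) = (\<lambda>n. T (hardy_coeff g n))"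
proof -
  obtain k where k: "0 \<le> k" "\<And>x. norm (T x) \<le> k * norm x" using Bop_bounded[OF T] by blast
  interpret bounded_analytic "\<lambda>z\<in>ball 0 1. T" k by (rule bounded_analytic_const[OF T k(2,1)])
  have sq: "sqsummable (\<lambda>n. T (hardy_coeff g n))"
    unfolding sqsummable_def
  proof (rule summable_comparison_test')
    show "summable (\<lambda>n. k\<^sup>2 * (norm (hardy_coeff g n))\<^sup>2)"
      by (intro summable_mult summable_hardy_coeff)
    show "norm ((norm (T (hardy_coeff g n)))\<^sup>2) \<le> k\<^sup>2 * (norm (hardy_coeff g n))\<^sup>2" for n
      using power_mono[OF k(2)[of "hardy_coeff g n"], of 2] by (simp add: power_mult_distrib)
  qed
  have "hardy_fun (toeplitz (\<lambda>z\<in>ball 0 1. T) g) z = taylor_fun (\<lambda>n. T (hardy_coeff g n)) z" for z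
  proof (cases "z \<in> ball 0 1")
    case True
    have "(\<lambda>n. T (z ^ n *\<^sub>C hardy_coeff g n)) sums T (hardy_fun g z)"
      by (rule bounded_linear.sums[OF Bop_bounded_linear[OF T] hardy_fun_sums[OF True]])
    then have "taylor_fun (\<lambda>n. T (hardy_coeff g n)) z = T (hardy_fun g z)"
      using True by (simp add: taylor_fun_def Bop_scaleC[OF T] sums_iff)
    then show ?thesis using hardy_fun_toeplitz[OF True, of g] True by simp
  next
    case False
    then show ?thesis by (simp add: hardy_fun_eq taylor_fun_def)
  qed
  then show ?thesis by (intro hardy_coeff_unique[OF sq]) (rule ext)
qed

lemma toeplitz_const_Bop: "T \<in> Bop \<Longrightarrow> toeplitz (\<lambda>z\<in>ball 0 1. T) \<in> Bop"
  using Bop_bounded[of T] bounded_analytic_const[of T] bounded_analytic.toeplitz_Bop by metis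

lemma hardy_fun_toeplitz_const:
  assumes "T \<in> Bop" "z \<in> ball 0 1"
  shows "hardy_fun (toeplitz (\<lambda>z\<in>ball 0 1. T) g) z = T (hardy_fun g z)"
proof -
  obtain K where K: "0 \<le> K" "\<And>x. norm (T x) \<le> K * norm x" using Bop_bounded[OF assms(1)] by blast
  interpret bounded_analytic "\<lambda>z\<in>ball 0 1. T" K by (rule bounded_analytic_const[OF assms(1) K(2,1)])
  show ?thesis using hardy_fun_toeplitz[OF assms(2), of g] assms(2) by simp
qed

lemma adj_toeplitz_const:
  assumes "T \<in> Bop"
  shows "adj (toeplitz (\<lambda>z\<in>ball 0 1. T)) = toeplitz (\<lambda>z\<in>ball 0 1. adj T)"
  by (rule adj_eqI) (simp add: cinner_hardy2_def hardy_coeff_toeplitz_const assms adj_Bop adj_cinner)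

lemma partial_isometry_toeplitz_const:
  assumes "partial_isometry T"
  shows "partial_isometry (toeplitz (\<lambda>z\<in>ball 0 1. T))"
proof -
  note T = partial_isometry_Bop[OF assms]
  have "toeplitz (\<lambda>z\<in>ball 0 1. T) (toeplitz (\<lambda>z\<in>ball 0 1. adj T) (toeplitz (\<lambda>z\<in>ball 0 1. T) g))
      = toeplitz (\<lambda>z\<in>ball 0 1. T) g" for g
    by (rule hardy_eqI)
      (simp add: hardy_coeff_toeplitz_const T adj_Bop partial_isometry_eq[OF assms])
  then show ?thesis
    by (auto simp: partial_isometry_def toeplitz_const_Bop T adj_toeplitz_const fun_eq_iff)
qed


section \<open>The equivalence class of a partial isometry\<close>

lemma onorm_on_le:
  assumes "\<And>x. x \<in> S \<Longrightarrow> norm (A x) \<le> K * norm x" "0 \<in> S" "0 \<le> K"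
  shows "onorm_on S A \<le> K"
  unfolding onorm_on_def
proof (rule cSUP_least)
  fix x assume "x \<in> S"
  then show "norm (A x) / norm x \<le> K"
    using assms(1)[of x] assms(3) by (cases "x = 0") (auto simp: divide_le_eq)
qed (use assms in auto)

lemma bdd_above_onorm_on:
  assumes "\<And>x. x \<in> S \<Longrightarrow> norm (A x) \<le> K * norm x"
  shows "bdd_above ((\<lambda>x. norm (A x) / norm x) ` S)"
proof (rule bdd_aboveI2)
  fix x assume "x \<in> S"
  then have "norm (A x) \<le> K * norm x" by (rule assms)
  \<comment> \<open>\<open>K\<close> may be negative if \<open>S\<close> contains no nonzero
    vector.\<close>
  also have "\<dots> \<le> max K 0 * norm x" by (intro mult_right_mono) auto
  finally show "norm (A x) / norm x \<le> max K 0"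
    by (cases "x = 0") (auto simp: divide_le_eq)
qed

lemma norm_le_onorm_on:
  assumes "\<And>x. x \<in> S \<Longrightarrow> norm (A x) \<le> K * norm x" "x \<in> S"
  shows "norm (A x) \<le> onorm_on S A * norm x"
proof (cases "x = 0")
  case True
  then show ?thesis using assms(1)[OF assms(2)] by simp
next
  case False
  have "norm (A x) / norm x \<le> onorm_on S A"
    unfolding onorm_on_def by (rule cSUP_upper[OF assms(2) bdd_above_onorm_on[OF assms(1)]])
  then show ?thesis using False by (simp add: divide_le_eq)
qed

lemma onorm_on_nonneg:
  assumes "\<And>x. x \<in> S \<Longrightarrow> norm (A x) \<le> K * norm x" "0 \<in> S"
  shows "0 \<le> onorm_on S A"
  using cSUP_upper[OF assms(2) bdd_above_onorm_on[OF assms(1)]] by (simp add: onorm_on_def)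

lemma Hinf_norm_leD:
  assumes F: "F \<in> Hinf1 S S'" and c: "Hinf_norm S F \<le> ereal c"
    and z: "z \<in> ball 0 1" and x: "x \<in> S"
  shows "norm (F z x) \<le> c * norm x"
proof -
  have "F z \<in> bounded_ops S S'" using F z by (auto simp: Hinf1_def)
  then obtain K where K: "\<And>x. x \<in> S \<Longrightarrow> norm (F z x) \<le> K * norm x"
    unfolding bounded_ops_def by blast
  have "ereal (onorm_on S (F z)) \<le> Hinf_norm S F"
    unfolding Hinf_norm_def by (rule SUP_upper[OF z])
  then have "onorm_on S (F z) \<le> c" using c order_trans by fastforce
  then have "onorm_on S (F z) * norm x \<le> c * norm x" by (rule mult_right_mono) simp
  then show ?thesis using norm_le_onorm_on[OF K x] by simp
qed

text \<open>\<open>onorm_on\<close> is a real supremum and bounds an operator only if that operator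
  is bounded; this supplies the boundedness for the error term of the derivative.\<close>

lemma Bop_difference_quotient:
  assumes "G w \<in> Bop" "G z \<in> Bop" "L \<in> Bop"
  shows "(\<lambda>x. c *\<^sub>C (G w x - G z x) - L x) \<in> Bop"
proof -
  have "(\<lambda>x. c *\<^sub>C x) \<in> Bop"
    by (simp add: bounded_ops_UNIV_iff bounded_linear_scaleC scaleC_scaleC mult.commute)
  from Bop_sub[OF Bop_comp[OF this Bop_sub[OF assms(1,2)]] assms(3)] show ?thesis .
qed

text \<open>If \<open>L\<close> is the derivative in operator norm, then
  \<open>cinner (L x) y\<close> is the derivative of the scalar function.\<close>

lemma Hinf1_cinner_holomorphic:
  assumes G: "G \<in> Hinf1 UNIV UNIV"
  shows "(\<lambda>z. cinner (G z x) y) holomorphic_on ball 0 1"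
  unfolding holomorphic_on_open[OF open_ball]
proof
  fix z :: complex assume z: "z \<in> ball 0 1"
  have GB: "G w \<in> Bop" if "w \<in> ball 0 1" for w
    using G that by (auto simp: Hinf1_def)
  obtain L where L: "L \<in> Bop"
    and lim: "((\<lambda>w. onorm_on UNIV (\<lambda>x. inverse (w - z) *\<^sub>C (G w x - G z x) - L x)) \<longlongrightarrow> 0) (at z)"
    using G z unfolding Hinf1_def analytic_op_def by blast
  let ?q = "\<lambda>w x. inverse (w - z) *\<^sub>C (G w x - G z x) - L x"
  have "((\<lambda>w. (cinner (G w x) y - cinner (G z x) y) / (w - z) - cinner (L x) y) \<longlongrightarrow> 0) (at z)"
  proof (rule Lim_null_comparison)
    have "\<forall>\<^sub>F w in at z. w \<in> ball 0 1"
      using z by (intro eventually_at_in_open') auto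
    then show "\<forall>\<^sub>F w in at z. norm ((cinner (G w x) y - cinner (G z x) y) / (w - z) - cinner (L x) y)
        \<le> onorm_on UNIV (?q w) * (norm x * norm y)"
    proof eventually_elim
      case (elim w)
      have "(cinner (G w x) y - cinner (G z x) y) / (w - z) - cinner (L x) y = cinner (?q w x) y"
        by (simp add: cinner_diff_left cinner_scaleC_left field_simps)
      then have "norm ((cinner (G w x) y - cinner (G z x) y) / (w - z) - cinner (L x) y)
          \<le> norm (?q w x) * norm y"
        using cmod_cinner_le by simp
      also obtain K where K: "\<And>x. norm (?q w x) \<le> K * norm x"
        using Bop_bounded[OF Bop_difference_quotient[OF GB[OF elim] GB[OF z] L]] by blast
      have "norm (?q w x) * norm y \<le> (onorm_on UNIV (?q w) * norm x) * norm y"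
        by (intro mult_right_mono norm_le_onorm_on[OF K]) auto
      finally show ?case by (simp add: mult.assoc)
    qed
    show "((\<lambda>w. onorm_on UNIV (?q w) * (norm x * norm y)) \<longlongrightarrow> 0) (at z)"
      by (rule tendsto_mult_left_zero[OF lim])
  qed
  then show "\<exists>f'. ((\<lambda>z. cinner (G z x) y) has_field_derivative f') (at z)"
    by (intro exI[of _ "cinner (L x) y"]) (simp add: has_field_derivative_iff LIM_zero_iff)
qed

lemma Hinf1_bounded_analytic:
  assumes G: "G \<in> Hinf1 UNIV UNIV"
  shows "bounded_analytic G 1"
proof
  have "Hinf_norm UNIV G \<le> ereal 1" using G by (simp add: Hinf1_def one_ereal_def)
  then show "norm (G z x) \<le> 1 * norm x" if "z \<in> ball 0 1" for z x
    using Hinf_norm_leD[OF G _ that] by blast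
qed (use G Hinf1_cinner_holomorphic[OF G] in \<open>auto simp: Hinf1_def\<close>)

text \<open>The identities on the symbol express that \<open>T\<close> dominates \<open>G\<close>;
  given these, the uniform strict bound expresses that \<open>G\<close> dominates
  \<open>T\<close>.\<close>

lemma Delta_inf_partial_isometry_iff:
  assumes T: "partial_isometry T"
  shows "G \<in> Delta_inf (\<lambda>z\<in>ball 0 1. T) \<longleftrightarrow> G \<in> Hinf1 UNIV UNIV \<and>
    (\<forall>z\<in>ball 0 1. \<forall>x. adj T (G z x) = adj T (T x) \<and> G z (adj T (T x)) = T x) \<and>
    (\<exists>c. 0 \<le> c \<and> c < 1 \<and> (\<forall>z\<in>ball 0 1. \<forall>x. T x = 0 \<longrightarrow> norm (G z x) \<le> c * norm x))"
    (is "_ \<longleftrightarrow> _ \<and> ?alg \<and> ?bound")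
proof (cases "G \<in> Hinf1 UNIV UNIV")
  case True
  note TB = partial_isometry_Bop[OF T]
  note T'B = adj_Bop[OF TB]
  let ?T = "\<lambda>z\<in>ball 0 1. T" and ?T' = "\<lambda>z\<in>ball 0 1. adj T"
  let ?A = "toeplitz ?T" and ?B = "toeplitz G"
  interpret bounded_analytic G 1 by (rule Hinf1_bounded_analytic[OF True])
  have B: "contraction ?B"
    using toeplitz_Bop norm_toeplitz_le by (simp add: contraction_iff)
  have A: "partial_isometry ?A" by (rule partial_isometry_toeplitz_const[OF T])
  note pointwise = hardy_fun_toeplitz_const[OF TB] hardy_fun_toeplitz_const[OF T'B] hardy_fun_toeplitz
  have dom: "shmulyan_dominates ?A ?B \<longleftrightarrow>
      (\<forall>h. toeplitz ?T' (?B h) = toeplitz ?T' (?A h)) \<and> (\<forall>h. ?B (toeplitz ?T' (?A h)) = ?A h)"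
    unfolding partial_isometry_dominates_iff[OF A] adj_toeplitz_const[OF TB] using B by simp
  have alg: "shmulyan_dominates ?A ?B \<longleftrightarrow> ?alg"
  proof
    assume d: "shmulyan_dominates ?A ?B"
    have "adj T (G z x) = adj T (T x) \<and> G z (adj T (T x)) = T x" if z: "z \<in> ball 0 1" for z x
    proof -
      \<comment> \<open>\<open>kernel 0 x\<close> is the constant function \<open>x\<close>.\<close>
      have "toeplitz ?T' (?B (kernel 0 x)) = toeplitz ?T' (?A (kernel 0 x))"
        "?B (toeplitz ?T' (?A (kernel 0 x))) = ?A (kernel 0 x)"
        using d unfolding dom by blast+
      from this[THEN arg_cong[where f = "\<lambda>g. hardy_fun g z"]] show ?thesis
        unfolding pointwise[OF z] hardy_fun_kernel_0[OF z] by simp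
    qed
    then show ?alg by blast
  next
    assume a: ?alg
    show "shmulyan_dominates ?A ?B"
      unfolding dom
    proof (intro conjI allI hardy2_eqI)
      fix h and z :: complex assume z: "z \<in> ball 0 1"
      show "hardy_fun (toeplitz ?T' (?B h)) z = hardy_fun (toeplitz ?T' (?A h)) z"
        "hardy_fun (?B (toeplitz ?T' (?A h))) z = hardy_fun (?A h) z"
        unfolding pointwise[OF z] using a z by blast+
    qed
  qed
  have "shmulyan_dominates ?B ?A \<longleftrightarrow> ?bound" if d: "shmulyan_dominates ?A ?B"
  proof
    assume "shmulyan_dominates ?B ?A"
    then obtain c where c: "0 \<le> c" "c < 1" "\<And>h. ?A h = 0 \<Longrightarrow> norm (?B h) \<le> c * norm h"
      by (rule shmulyan_dominates_strict_bound) blast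
    have "norm (G z x) \<le> c * norm x" if z: "z \<in> ball 0 1" and x: "T x = 0" for z x
    proof (rule pointwise_norm_le[OF z])
      have "?A (kernel z x) = 0"
        by (rule hardy_eqI) (simp add: hardy_coeff_toeplitz_const[OF TB] hardy_coeff_kernel[OF z]
            hardy_coeff_zero Bop_scaleC[OF TB] x)
      then show "norm (?B (kernel z x)) \<le> c * norm (kernel z x)" by (rule c(3))
    qed
    with c show ?bound by blast
  next
    assume ?bound
    then obtain c where c: "0 \<le> c" "c < 1"
      and Gc: "\<And>z x. z \<in> ball 0 1 \<Longrightarrow> T x = 0 \<Longrightarrow> norm (G z x) \<le> c * norm x" by blast
    \<comment> \<open>\<open>G - T\<close> factors through the projection onto the kernel of
      \<open>T\<close>, so the bound \<open>c\<close> holds for it on all vectors. Its Toeplitz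
      operator thus has norm at most \<open>c\<close>, and it agrees with \<open>?B\<close> on the
      kernel of \<open>?A\<close>.\<close>
    let ?C = "\<lambda>z x. G z x - T x"
    interpret C: bounded_analytic ?C c
    proof
      fix z :: complex and x y assume z: "z \<in> ball 0 1"
      show "?C z \<in> Bop" by (rule Bop_sub[OF F_Bop[OF z] TB])
      have "?C z x = G z (x - adj T (T x))"
        using d z by (simp add: alg Bop_diff[OF F_Bop[OF z]])
      also have "norm \<dots> \<le> c * norm (x - adj T (T x))"
        by (rule Gc[OF z]) (simp add: Bop_diff[OF TB] partial_isometry_eq[OF T])
      also have "\<dots> \<le> c * norm x"
      proof (intro mult_left_mono c, rule power2_le_imp_le)
        show "(norm (x - adj T (T x)))\<^sup>2 \<le> (norm x)\<^sup>2"
          using norm_defect_op[OF partial_isometry_contraction[OF T], of x]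
          by (simp add: defect_op_partial_isometry[OF T])
      qed simp
      finally show "norm (?C z x) \<le> c * norm x" .
    next
      show "(\<lambda>z. cinner (?C z x) y) holomorphic_on ball 0 1" for x y
        unfolding cinner_diff_left by (intro holomorphic_intros F_holo)
    qed (rule c)
    show "shmulyan_dominates ?B ?A"
    proof (rule dominates_partial_isometryI[OF A d c(2,1)])
      fix h assume h: "?A h = 0"
      have "toeplitz ?C h = ?B h - ?A h"
        by (rule hardy2_eqI)
          (simp add: C.hardy_fun_toeplitz pointwise hardy_fun_diff del: mem_ball)
      then show "norm (?B h) \<le> c * norm h" using C.norm_toeplitz_le[of h] h by simp
    qed
  qed
  then show ?thesis
    using True alg unfolding Delta_inf_def sth_dominates_def by blast
next
  case False
  then show ?thesis by (simp add: Delta_inf_def)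
qed

lemma Hinf1_restrict_defect_spaces:
  assumes T: "partial_isometry T" and G: "G \<in> Hinf1 UNIV UNIV"
    and alg: "\<And>z x. z \<in> ball 0 1 \<Longrightarrow> T x = 0 \<Longrightarrow> adj T (G z x) = 0"
    and c: "0 \<le> c" "c < 1" "\<And>z x. z \<in> ball 0 1 \<Longrightarrow> T x = 0 \<Longrightarrow> norm (G z x) \<le> c * norm x"
  defines "F \<equiv> \<lambda>z\<in>ball 0 1. restrict (G z) {x. T x = 0}"
  shows "F \<in> Hinf1 {x. T x = 0} {y. adj T y = 0}" and "Hinf_norm {x. T x = 0} F < 1"
proof -
  note TB = partial_isometry_Bop[OF T]
  note T'B = adj_Bop[OF TB]
  let ?S = "{x. T x = 0}" and ?S' = "{y. adj T y = 0}"
  have S0: "0 \<in> ?S" using Bop_zero[OF TB] by simp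
  have Ssub: "x + y \<in> ?S" "a *\<^sub>C x \<in> ?S" if "x \<in> ?S" "y \<in> ?S" for x y a
    using that by (simp_all add: Bop_add[OF TB] Bop_scaleC[OF TB])
  have restr: "restrict H ?S \<in> bounded_ops ?S ?S'"
    if H: "H \<in> Bop" and HS: "\<And>x. T x = 0 \<Longrightarrow> adj T (H x) = 0" for H
  proof -
    obtain K where "\<And>x. norm (H x) \<le> K * norm x" using Bop_bounded[OF H] by blast
    then show ?thesis
      using HS Ssub by (auto simp: bounded_ops_def Bop_add[OF H] Bop_scaleC[OF H]
          intro!: exI[of _ K])
  qed
  have GB: "G w \<in> Bop" if "w \<in> ball 0 1" for w
    using G that by (auto simp: Hinf1_def)
  have F: "F \<in> ball 0 1 \<rightarrow>\<^sub>E bounded_ops ?S ?S'"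
    unfolding F_def by (intro restrict_PiE_iff[THEN iffD2] ballI restr GB alg)
  have "onorm_on ?S (F z) \<le> c" if "z \<in> ball 0 1" for z
    using that by (intro onorm_on_le) (auto simp: F_def c Bop_zero[OF TB])
  then have "Hinf_norm ?S F \<le> ereal c"
    unfolding Hinf_norm_def by (intro SUP_least) simp
  then show lt: "Hinf_norm ?S F < 1"
    using c(2) by (metis ereal_less(3) le_less_trans less_ereal.simps(1) one_ereal_def)
  have "analytic_op ?S ?S' F"
    unfolding analytic_op_def
  proof
    fix z :: complex assume z: "z \<in> ball 0 1"
    obtain L where L: "L \<in> Bop"
      and lim: "((\<lambda>w. onorm_on UNIV (\<lambda>x. inverse (w - z) *\<^sub>C (G w x - G z x) - L x)) \<longlongrightarrow> 0) (at z)"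
      using G z unfolding Hinf1_def analytic_op_def by blast
    let ?q = "\<lambda>w x. inverse (w - z) *\<^sub>C (G w x - G z x) - L x"
    let ?Q = "defect_op (adj T)"
    have Q: "?Q = (\<lambda>y. y - T (adj T y))" by (rule defect_op_adj_partial_isometry[OF T])
    have QB: "?Q \<in> Bop"
      by (rule defect_op_Bop[OF partial_isometry_contraction[OF partial_isometry_adj[OF T]]])
    have nQ: "norm (?Q y) \<le> norm y" for y
    proof (rule power2_le_imp_le)
      show "(norm (?Q y))\<^sup>2 \<le> (norm y)\<^sup>2"
        using norm_defect_op[OF partial_isometry_contraction[OF partial_isometry_adj[OF T]], of y] by simp
    qed simp
    \<comment> \<open>The derivative \<open>L\<close> is not yet known to map into the kernel of T*.
      It is compressed by the contraction \<open>?Q\<close>, which fixes the values of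
      \<open>G\<close> on the kernel of \<open>T\<close>, so the error can only shrink.\<close>
    let ?L = "restrict (\<lambda>x. ?Q (L x)) ?S"
    let ?p = "\<lambda>w x. inverse (w - z) *\<^sub>C (F w x - F z x) - ?L x"
    have "?L \<in> bounded_ops ?S ?S'"
      by (rule restr[OF Bop_comp[OF QB L]])
        (simp add: Q Bop_diff[OF T'B] partial_isometry_adj_eq[OF T])
    moreover have "((\<lambda>w. onorm_on ?S (?p w)) \<longlongrightarrow> 0) (at z)"
    proof (rule Lim_null_comparison[OF _ lim])
      have "\<forall>\<^sub>F w in at z. w \<in> ball 0 1"
        using z by (intro eventually_at_in_open') auto
      then show "\<forall>\<^sub>F w in at z. norm (onorm_on ?S (?p w)) \<le> onorm_on UNIV (?q w)"
      proof eventually_elim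
        case (elim w)
        obtain K where K: "\<And>x. norm (?q w x) \<le> K * norm x"
          using Bop_bounded[OF Bop_difference_quotient[OF GB[OF elim] GB[OF z] L]] by blast
        have pq: "norm (?p w x) \<le> onorm_on UNIV (?q w) * norm x" if x: "x \<in> ?S" for x
        proof -
          have QG: "?Q (G v x) = G v x" if "v \<in> ball 0 1" for v
            using alg[OF that] x by (simp add: Q Bop_zero[OF TB])
          have "?p w x = ?Q (?q w x)"
            using x elim z QG[OF elim] QG[OF z]
            by (simp add: F_def Bop_diff[OF QB] Bop_scaleC[OF QB] del: mem_ball)
          then have "norm (?p w x) \<le> norm (?q w x)" using nQ by simp
          also have "\<dots> \<le> onorm_on UNIV (?q w) * norm x"
            by (rule norm_le_onorm_on[OF K]) auto
          finally show ?thesis .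
        qed
        have "0 \<le> onorm_on ?S (?p w)" by (rule onorm_on_nonneg[OF pq S0])
        moreover have "onorm_on ?S (?p w) \<le> onorm_on UNIV (?q w)"
          by (rule onorm_on_le[OF pq S0 onorm_on_nonneg[OF K]]) auto
        ultimately show ?case by simp
      qed
    qed
    ultimately show "\<exists>L\<in>bounded_ops ?S ?S'.
        ((\<lambda>w. onorm_on ?S (\<lambda>x. inverse (w - z) *\<^sub>C (F w x - F z x) - L x)) \<longlongrightarrow> 0) (at z)"
      by blast
  qed
  with F lt show "F \<in> Hinf1 ?S ?S'" by (auto simp: Hinf1_def less_imp_le)
qed

theorem theorem4p3:
  fixes T :: "'a::chilbert_space \<Rightarrow> 'b::chilbert_space"
  assumes "separable_space (euclidean :: 'a topology)"
    and "separable_space (euclidean :: 'b topology)"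
    and "partial_isometry T"
  shows "Delta_inf (\<lambda>z\<in>ball 0 1. T) =
    {F \<in> Hinf1 UNIV UNIV.
       \<exists>F\<^sub>0 \<in> Hinf1 (defect_space T) (defect_space (adj T)).
         Hinf_norm (defect_space T) F\<^sub>0 < 1 \<and>
         F = (\<lambda>z\<in>ball 0 1. \<lambda>x. T x + defect_op (adj T) (F\<^sub>0 z (defect_op T x)))}"
proof -
  note T = assms(3)
  note TB = partial_isometry_Bop[OF T]
  note T'B = adj_Bop[OF TB]
  let ?S = "{x. T x = 0}" and ?S' = "{y. adj T y = 0}"
  note D = defect_op_partial_isometry[OF T] defect_op_adj_partial_isometry[OF T]
    defect_space_partial_isometry[OF T] defect_space_partial_isometry[OF partial_isometry_adj[OF T]]
  have "G \<in> Delta_inf (\<lambda>z\<in>ball 0 1. T) \<longleftrightarrow> (\<exists>F\<^sub>0 \<in> Hinf1 ?S ?S'. Hinf_norm ?S F\<^sub>0 < 1 \<and>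
      G = (\<lambda>z\<in>ball 0 1. \<lambda>x. T x + defect_op (adj T) (F\<^sub>0 z (defect_op T x))))"
    if G: "G \<in> Hinf1 UNIV UNIV" for G
  proof
    assume "G \<in> Delta_inf (\<lambda>z\<in>ball 0 1. T)"
    then obtain c where alg1: "\<And>z x. z \<in> ball 0 1 \<Longrightarrow> adj T (G z x) = adj T (T x)"
      and alg2: "\<And>z x. z \<in> ball 0 1 \<Longrightarrow> G z (adj T (T x)) = T x"
      and c: "0 \<le> c" "c < 1" "\<And>z x. z \<in> ball 0 1 \<Longrightarrow> T x = 0 \<Longrightarrow> norm (G z x) \<le> c * norm x"
      unfolding Delta_inf_partial_isometry_iff[OF T] by blast
    \<comment> \<open>This choice is forced: on the kernel of \<open>T\<close> the required formula
      reduces to G = F0.\<close>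
    define F0 where "F0 = (\<lambda>z\<in>ball 0 1. restrict (G z) ?S)"
    have "adj T (G z x) = 0" if "z \<in> ball 0 1" "T x = 0" for z x
      using alg1[OF that(1), of x] that(2) by (simp add: Bop_zero[OF T'B])
    note F0 = Hinf1_restrict_defect_spaces[OF T G this c, folded F0_def]
    have "G = (\<lambda>z\<in>ball 0 1. \<lambda>x. T x + defect_op (adj T) (F0 z (defect_op T x)))"
    proof (rule extensionalityI[of _ "ball 0 1"])
      show "G \<in> extensional (ball 0 1)" using G by (auto simp: Hinf1_def PiE_def)
      fix z :: complex assume z: "z \<in> ball 0 1"
      have GB: "G z \<in> Bop" using G z by (auto simp: Hinf1_def)
      show "G z = (\<lambda>z\<in>ball 0 1. \<lambda>x. T x + defect_op (adj T) (F0 z (defect_op T x))) z"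
      proof
        fix x
        have "defect_op T x \<in> ?S" by (simp add: D Bop_diff[OF TB] partial_isometry_eq[OF T])
        then have "F0 z (defect_op T x) = G z x - T x"
          using z alg2[OF z, of x] by (simp add: F0_def D Bop_diff[OF GB])
        then show "G z x = (\<lambda>z\<in>ball 0 1. \<lambda>x. T x + defect_op (adj T) (F0 z (defect_op T x))) z x"
          using z alg1[OF z, of x] by (simp add: D Bop_diff[OF T'B] Bop_zero[OF TB])
      qed
    qed simp
    with F0 show "\<exists>F\<^sub>0 \<in> Hinf1 ?S ?S'. Hinf_norm ?S F\<^sub>0 < 1 \<and>
        G = (\<lambda>z\<in>ball 0 1. \<lambda>x. T x + defect_op (adj T) (F\<^sub>0 z (defect_op T x)))" by blast
  next
    assume "\<exists>F\<^sub>0 \<in> Hinf1 ?S ?S'. Hinf_norm ?S F\<^sub>0 < 1 \<and>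
      G = (\<lambda>z\<in>ball 0 1. \<lambda>x. T x + defect_op (adj T) (F\<^sub>0 z (defect_op T x)))"
    then obtain F0 where F0: "F0 \<in> Hinf1 ?S ?S'" and lt: "Hinf_norm ?S F0 < 1"
      and G_eq: "G = (\<lambda>z\<in>ball 0 1. \<lambda>x. T x + defect_op (adj T) (F0 z (defect_op T x)))" by blast
    \<comment> \<open>A real bound strictly between the norm and 1 turns the strict inequality into
      a uniform constant; the maximum with 0 gives its nonnegativity directly.\<close>
    obtain c' where c': "Hinf_norm ?S F0 < ereal c'" "ereal c' < 1"
      using ereal_dense2[OF lt] by blast
    define c where "c = max c' 0"
    have c: "0 \<le> c" "c < 1" "Hinf_norm ?S F0 \<le> ereal c"
      using c' by (auto simp: c_def one_ereal_def max_def intro: order_trans less_imp_le)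
    have F0z: "F0 z \<in> bounded_ops ?S ?S'" if "z \<in> ball 0 1" for z
      using F0 that by (auto simp: Hinf1_def)
    have S0: "0 \<in> ?S" using Bop_zero[OF TB] by simp
    have F00: "F0 z 0 = 0" if "z \<in> ball 0 1" for z
    proof -
      have "F0 z (0 *\<^sub>C 0) = 0 *\<^sub>C F0 z 0"
        using F0z[OF that] S0 unfolding bounded_ops_def by blast
      then show ?thesis by simp
    qed
    have in_S: "x - adj T (T x) \<in> ?S" for x
      by (simp add: Bop_diff[OF TB] partial_isometry_eq[OF T])
    have F0S': "adj T (F0 z x) = 0" if "z \<in> ball 0 1" "x \<in> ?S" for z x
      using F0z[OF that(1)] that(2) unfolding bounded_ops_def by blast
    have Gz: "G z x = T x + F0 z (x - adj T (T x))" if z: "z \<in> ball 0 1" for z x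
      using z F0S'[OF z in_S, of x] by (simp add: G_eq D Bop_zero[OF TB])
    have "adj T (G z x) = adj T (T x) \<and> G z (adj T (T x)) = T x" if z: "z \<in> ball 0 1" for z x
      using F0S'[OF z in_S]
      by (simp add: Gz[OF z] Bop_add[OF T'B] partial_isometry_eq[OF T] F00[OF z])
    moreover have "norm (G z x) \<le> c * norm x" if z: "z \<in> ball 0 1" and x: "T x = 0" for z x
      using Hinf_norm_leD[OF F0 c(3) z, of x] x by (simp add: Gz[OF z] Bop_zero[OF T'B])
    ultimately show "G \<in> Delta_inf (\<lambda>z\<in>ball 0 1. T)"
      unfolding Delta_inf_partial_isometry_iff[OF T] using G c by blast
  qed
  moreover have "Delta_inf (\<lambda>z\<in>ball 0 1. T) \<subseteq> Hinf1 UNIV UNIV"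
    by (auto simp: Delta_inf_def)
  ultimately show ?thesis
    unfolding defect_space_partial_isometry[OF T]
      defect_space_partial_isometry[OF partial_isometry_adj[OF T]] by blast
qed

end
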